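(* Let $\nabla$ be an $h$-connection of $E$. The topological holonomy group $G_\nabla$ of $\nabla$ is finite if and only if both of the topological holonomy groups $G_{\hat\nabla,+}$ and $G_{\hat\nabla,-}$ are finite.
   Context: Let $T^2=S^1\times S^1$ with $S^1=\mathbb{R}/2\pi\mathbb{Z}$ and let $\mathrm{pr}:\mathbb{R}^2\to T^2$ be the projection. $E$ is an oriented real vector bundle of rank 4 over $T^2$ with a positive-definite metric $h$. An $h$-connection is a connection $\nabla$ of $E$ with $\nabla h=0$. Definition of $G_\nabla$: let $(\tilde v_1,\dots,\tilde v_4)$ be a positively oriented orthonormal basis of $\mathrm{pr}^*E_{(0,0)}$, and let $\tilde\xi_{i,x}$ (resp. $\tilde\xi_{i,y}$) be the $\nabla$-parallel sections of $\mathrm{pr}^*E$ along the $x$-axis (resp. $y$-axis) with value $\tilde v_i$ at $(0,0)$. Identifying the fibers of the pull-back at $(x+2\pi m,y+2\pi n)$ and $(x,y)$ for $m,n\in\mathbb{Z}$, there are $A_1,A_2\in SO(4)$ with $(\tilde\xi_{i,x}(a+2\pi,0))_{i}=(\tilde\xi_{i,x}(a,0))_{i}A_1$ and $(\tilde\xi_{i,y}(0,b+2\pi))_{i}=(\tilde\xi_{i,y}(0,b))_{i}A_2$ for all $a,b\in\mathbb{R}$ (row vectors times matrices). $G_\nabla$ is the subgroup of $SO(4)$ generated by $A_1,A_2$ (determined up to conjugation). Definition of $G_{\hat\nabla,\varepsilon}$, $\varepsilon\in\{+,-\}$: $\bigwedge^2E$ with the induced metric $\hat h$ decomposes into rank 3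 subbundles $\bigwedge^2_+E\oplus\bigwedge^2_-E$: for a local positively oriented orthonormal frame $(e_1,e_2,e_3,e_4)$ of $E$, $\bigwedge^2_\pm E$ has the local orthonormal frame $\Omega_{\pm,1}=\frac1{\sqrt2}(e_1\wedge e_2\pm e_3\wedge e_4)$, $\Omega_{\pm,2}=\frac1{\sqrt2}(e_1\wedge e_3\pm e_4\wedge e_2)$, $\Omega_{\pm,3}=\frac1{\sqrt2}(e_1\wedge e_4\pm e_2\wedge e_3)$, and is oriented by it. $\nabla$ induces an $\hat h$-connection $\hat\nabla$ of $\bigwedge^2E$, which restricts to $\bigwedge^2_\pm E$. Fix a positively oriented orthonormal basis $(\omega_{\varepsilon,1},\omega_{\varepsilon,2},\omega_{\varepsilon,3})$ of the fiber of $\bigwedge^2_\varepsilon E$ at $\mathrm{pr}(0,0)$; the $\hat\nabla$-parallel sections $\tilde\Omega_{\varepsilon,i,x}$, $\tilde\Omega_{\varepsilon,i,y}$ of $\mathrm{pr}^*\bigwedge^2_\varepsilon E$ along the $x$- and $y$-axis with value $\omega_{\varepsilon,i}$ at $(0,0)$ satisfy $(\tilde\Omega_{\varepsilon,i,x}(a+2\pi,0))_{i}=(\tilde\Omega_{\varepsilon,i,x}(a,0))_{i}C_{\varepsilon,1}$ and $(\tilde\Omega_{\varepsilon,i,y}(0,b+2\pi))_{i}=(\tilde\Omega_{\varepsilon,i,y}(0,b))_{i}C_{\varepsilon,2}$ for all $a,b\in\mathbb R$, with $C_{\varepsilon,1},C_{\varepsilon,2}\in SO(3)$. $G_{\hat\nabla,\varepsilon}$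 is the subgroup of $SO(3)$ generated by $C_{\varepsilon,1},C_{\varepsilon,2}$ (determined up to conjugation). *)

theory Defs
  imports "HOL-Analysis.Analysis" "HOL-Algebra.Generated_Groups"
begin

section \<open>Smooth functions\<close>

text \<open>Being \<open>k\<close> times continuously differentiable on a set, which is meant to be open; the partial
  derivatives are taken in all directions.\<close>

primrec Ck_on :: "nat \<Rightarrow> 'a::real_normed_vector set \<Rightarrow> ('a \<Rightarrow> real) \<Rightarrow> bool" where
  "Ck_on 0 S f \<longleftrightarrow> continuous_on S f"
| "Ck_on (Suc k) S f \<longleftrightarrow>
     (\<forall>x\<in>S. f differentiable (at x)) \<and>
     (\<forall>v. Ck_on k S (\<lambda>x. frechet_derivative f (at x) v))"

definition smooth_fun_on :: "'a::real_normed_vector set \<Rightarrow> ('a \<Rightarrow> real) \<Rightarrow> bool" where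
  "smooth_fun_on S f \<longleftrightarrow> (\<forall>k. Ck_on k S f)"


section \<open>The torus\<close>

quotient_type circle = real / "\<lambda>x y. \<exists>k::int. x - y = 2 * pi * of_int k"
proof (intro equivpI reflpI sympI transpI)
  fix x :: real
  show "\<exists>k::int. x - x = 2 * pi * of_int k"
    by (intro exI[of _ 0]) simp
next
  fix x y :: real
  assume "\<exists>k::int. x - y = 2 * pi * of_int k"
  then obtain k :: int where "x - y = 2 * pi * of_int k" by blast
  then have "y - x = 2 * pi * of_int (- k)" by simp
  then show "\<exists>k::int. y - x = 2 * pi * of_int k" by blast
next
  fix x y z :: real
  assume "\<exists>k::int. x - y = 2 * pi * of_int k" "\<exists>k::int. y - z = 2 * pi * of_int k"
  then obtain k l :: int where "x - y = 2 * pi * of_int k" "y - z = 2 * pi * of_int l" by blast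
  then have "x - z = 2 * pi * of_int (k + l)" by (simp add: algebra_simps)
  then show "\<exists>k::int. x - z = 2 * pi * of_int k" by blast
qed

type_synonym torus = "circle \<times> circle"

definition pr :: "real \<times> real \<Rightarrow> torus" where
  "pr z = (abs_circle (fst z), abs_circle (snd z))"

text \<open>The torus carries the topology and the smooth structure for which \<^term>\<open>pr\<close> is a covering
  map and a local diffeomorphism. Its tangent spaces are identified with the plane by the
  differential of \<^term>\<open>pr\<close>, which at a point of the torus does not depend on the chosen lift.\<close>

definition torus_open :: "torus set \<Rightarrow> bool" where
  "torus_open U \<longleftrightarrow> open (pr -` U)"

definition torus_smooth_on :: "torus set \<Rightarrow> (torus \<Rightarrow> real) \<Rightarrow> bool" where
  "torus_smooth_on U f \<longleftrightarrow> smooth_fun_on (pr -` U) (\<lambda>z. f (pr z))"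

text \<open>The derivative at \<open>pr z\<close> of a function on the torus in the direction \<open>v\<close>.\<close>

definition torus_deriv :: "(torus \<Rightarrow> real) \<Rightarrow> real \<times> real \<Rightarrow> real \<times> real \<Rightarrow> real" where
  "torus_deriv f z v = frechet_derivative (\<lambda>w. f (pr w)) (at z) v"


section \<open>Oriented vector bundles of rank 4 over the torus\<close>

text \<open>The fibres are linear subspaces of one ambient real vector space \<open>'e\<close>, which has no topology
  and only serves as a carrier: every bundle has this form up to isomorphism, for instance with
  the direct sum of all its fibres as ambient space. The smooth structure and the orientation are
  given by an atlas of local frames, that is, of local trivializations.\<close>

record 'e vbundle =
  fibre :: "torus \<Rightarrow> 'e set"
  frames :: "(torus set \<times> (4 \<Rightarrow> torus \<Rightarrow> 'e)) set"

definition oriented_vbundle :: "'e::real_vector vbundle \<Rightarrow> bool" where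
  "oriented_vbundle E \<longleftrightarrow>
     (\<forall>p. subspace (fibre E p)) \<and>
     (\<forall>(U, e) \<in> frames E. torus_open U \<and>
        (\<forall>p\<in>U. inj (\<lambda>i. e i p) \<and> independent (range (\<lambda>i. e i p)) \<and>
               span (range (\<lambda>i. e i p)) = fibre E p)) \<and>
     (\<forall>p. \<exists>(U, e) \<in> frames E. p \<in> U) \<and>
     (\<forall>(U, e) \<in> frames E. \<forall>(V, f) \<in> frames E. \<exists>g :: torus \<Rightarrow> real^4^4.
        (\<forall>i j. torus_smooth_on (U \<inter> V) (\<lambda>p. g p $ i $ j)) \<and>
        (\<forall>p \<in> U \<inter> V. det (g p) > 0 \<and> (\<forall>j. f j p = (\<Sum>i\<in>UNIV. g p $ i $ j *\<^sub>R e i p))))"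

definition positively_oriented :: "'e::real_vector vbundle \<Rightarrow> torus \<Rightarrow> (4 \<Rightarrow> 'e) \<Rightarrow> bool" where
  "positively_oriented E p v \<longleftrightarrow>
     (\<exists>(U, e) \<in> frames E. p \<in> U \<and>
        (\<exists>M :: real^4^4. det M > 0 \<and> (\<forall>j. v j = (\<Sum>i\<in>UNIV. M $ i $ j *\<^sub>R e i p))))"

text \<open>Smooth sections over an open set; their values outside of the set are irrelevant.\<close>

definition sections :: "'e::real_vector vbundle \<Rightarrow> torus set \<Rightarrow> (torus \<Rightarrow> 'e) set" where
  "sections E U = {s. (\<forall>p\<in>U. s p \<in> fibre E p) \<and>
     (\<forall>(V, e) \<in> frames E. \<exists>f. (\<forall>i. torus_smooth_on (U \<inter> V) (f i)) \<and>
        (\<forall>p \<in> U \<inter> V. s p = (\<Sum>i\<in>UNIV. f i p *\<^sub>R e i p)))}"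

definition bundle_metric :: "'e::real_vector vbundle \<Rightarrow> (torus \<Rightarrow> 'e \<Rightarrow> 'e \<Rightarrow> real) \<Rightarrow> bool" where
  "bundle_metric E h \<longleftrightarrow>
     (\<forall>p. \<forall>u\<in>fibre E p. \<forall>v\<in>fibre E p. \<forall>w\<in>fibre E p. \<forall>c.
        h p (u + v) w = h p u w + h p v w \<and> h p (c *\<^sub>R u) w = c * h p u w \<and>
        h p u v = h p v u \<and> (u \<noteq> 0 \<longrightarrow> h p u u > 0)) \<and>
     (\<forall>U s t. torus_open U \<longrightarrow> s \<in> sections E U \<longrightarrow> t \<in> sections E U \<longrightarrow>
        torus_smooth_on U (\<lambda>p. h p (s p) (t p)))"

definition positive_onb ::
    "'e::real_vector vbundle \<Rightarrow> (torus \<Rightarrow> 'e \<Rightarrow> 'e \<Rightarrow> real) \<Rightarrow> torus \<Rightarrow> (4 \<Rightarrow> 'e) \<Rightarrow> bool" where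
  "positive_onb E h p v \<longleftrightarrow>
     (\<forall>i j. h p (v i) (v j) = (if i = j then 1 else 0)) \<and> positively_oriented E p v"


section \<open>Connections and parallel sections\<close>

text \<open>A connection acts on local smooth sections. \<open>D v s\<close> is the covariant derivative of \<open>s\<close> in the
  direction of the constant vector field \<open>v\<close> on the torus. Since the constant vector fields form
  a global frame of the tangent bundle, the derivative in the direction of a general vector
  field is determined by linearity over the smooth functions.\<close>

type_synonym 'e conn = "real \<times> real \<Rightarrow> (torus \<Rightarrow> 'e) \<Rightarrow> torus \<Rightarrow> 'e"

definition connection :: "'e::real_vector vbundle \<Rightarrow> 'e conn \<Rightarrow> bool" where
  "connection E D \<longleftrightarrow> (\<forall>U. torus_open U \<longrightarrow>
     (\<forall>s\<in>sections E U. \<forall>v. D v s \<in> sections E U) \<and>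
     (\<forall>s\<in>sections E U. \<forall>p\<in>U. linear (\<lambda>v. D v s p)) \<and>
     (\<forall>s\<in>sections E U. \<forall>t\<in>sections E U. \<forall>v. \<forall>p\<in>U.
        D v (\<lambda>q. s q + t q) p = D v s p + D v t p) \<and>
     (\<forall>s\<in>sections E U. \<forall>f v z. torus_smooth_on U f \<longrightarrow> pr z \<in> U \<longrightarrow>
        D v (\<lambda>q. f q *\<^sub>R s q) (pr z) =
          torus_deriv f z v *\<^sub>R s (pr z) + f (pr z) *\<^sub>R D v s (pr z)) \<and>
     (\<forall>s\<in>sections E U. \<forall>t. (\<forall>q\<in>U. s q = t q) \<longrightarrow> (\<forall>v. \<forall>p\<in>U. D v s p = D v t p)))"

definition metric_connection ::
    "'e::real_vector vbundle \<Rightarrow> (torus \<Rightarrow> 'e \<Rightarrow> 'e \<Rightarrow> real) \<Rightarrow> 'e conn \<Rightarrow> bool" where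
  "metric_connection E h D \<longleftrightarrow> connection E D \<and>
     (\<forall>U. torus_open U \<longrightarrow> (\<forall>s\<in>sections E U. \<forall>t\<in>sections E U. \<forall>v z. pr z \<in> U \<longrightarrow>
        torus_deriv (\<lambda>q. h q (s q) (t q)) z v =
          h (pr z) (D v s (pr z)) (t (pr z)) + h (pr z) (s (pr z)) (D v t (pr z))))"

text \<open>Covariant derivative along a line. \<open>\<Gamma> U\<close> is the set of smooth sections over \<open>U\<close> of a bundle
  with connection \<open>D\<close>, and \<open>u\<close> is a section of its pull-back by \<^term>\<open>pr\<close> along the line
  \<open>r \<mapsto> r *\<^sub>R d\<close>, so that \<open>u r\<close> lies in the fibre at \<open>pr (r *\<^sub>R d)\<close>. Near \<open>t\<close>, \<open>u\<close> is a
  combination of pulled back smooth sections with smooth coefficients, and \<open>w\<close> is its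
  derivative at \<open>t\<close> for the pull-back of \<open>D\<close>.\<close>

definition has_covariant_derivative ::
    "(torus set \<Rightarrow> (torus \<Rightarrow> 'e::real_vector) set) \<Rightarrow> 'e conn \<Rightarrow> real \<times> real \<Rightarrow>
     (real \<Rightarrow> 'e) \<Rightarrow> 'e \<Rightarrow> real \<Rightarrow> bool" where
  "has_covariant_derivative \<Gamma> D d u w t \<longleftrightarrow>
     (\<exists>I U (n::nat) f s. open I \<and> t \<in> I \<and> torus_open U \<and> (\<forall>r\<in>I. pr (r *\<^sub>R d) \<in> U) \<and>
        (\<forall>k<n. smooth_fun_on I (f k) \<and> s k \<in> \<Gamma> U) \<and>
        (\<forall>r\<in>I. u r = (\<Sum>k<n. f k r *\<^sub>R s k (pr (r *\<^sub>R d)))) \<and>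
        w = (\<Sum>k<n. deriv (f k) t *\<^sub>R s k (pr (t *\<^sub>R d)) + f k t *\<^sub>R D d (s k) (pr (t *\<^sub>R d))))"

definition parallel_along ::
    "(torus set \<Rightarrow> (torus \<Rightarrow> 'e::real_vector) set) \<Rightarrow> 'e conn \<Rightarrow> real \<times> real \<Rightarrow>
     (real \<Rightarrow> 'e) \<Rightarrow> bool" where
  "parallel_along \<Gamma> D d u \<longleftrightarrow> (\<forall>t. has_covariant_derivative \<Gamma> D d u 0 t)"


section \<open>Holonomy groups\<close>

definition SO_group :: "(real^'n^'n) monoid" where
  "SO_group = \<lparr>carrier = {A. orthogonal_matrix A \<and> det A = 1},
               monoid.mult = (**), one = mat 1\<rparr>"

text \<open>\<open>A\<close> is the matrix of the holonomy along the projection of the line \<open>r \<mapsto> r *\<^sub>R d\<close>, with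
  \<open>d\<close> one of the two standard basis vectors, relative to the basis \<open>v\<close> of the fibre at
  \<open>pr (0, 0)\<close>. Rows of vectors are multiplied by matrices from the right.\<close>

definition holonomy_matrix ::
    "(torus set \<Rightarrow> (torus \<Rightarrow> 'e::real_vector) set) \<Rightarrow> 'e conn \<Rightarrow> real \<times> real \<Rightarrow>
     ('n::finite \<Rightarrow> 'e) \<Rightarrow> real^'n^'n \<Rightarrow> bool" where
  "holonomy_matrix \<Gamma> D d v A \<longleftrightarrow> A \<in> carrier SO_group \<and>
     (\<exists>\<xi>. (\<forall>i. parallel_along \<Gamma> D d (\<xi> i) \<and> \<xi> i 0 = v i) \<and>
          (\<forall>a j. \<xi> j (a + 2 * pi) = (\<Sum>i\<in>UNIV. A $ i $ j *\<^sub>R \<xi> i a)))"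

text \<open>The topological holonomy groups are determined up to conjugation only, so they are
  introduced by predicates which hold for the groups obtained from any admissible basis of the
  fibre at \<open>pr (0, 0)\<close>.\<close>

definition topological_holonomy_group ::
    "'e::real_vector vbundle \<Rightarrow> (torus \<Rightarrow> 'e \<Rightarrow> 'e \<Rightarrow> real) \<Rightarrow> 'e conn \<Rightarrow>
     (real^4^4) set \<Rightarrow> bool" where
  "topological_holonomy_group E h D G \<longleftrightarrow>
     (\<exists>v A1 A2. positive_onb E h (pr (0, 0)) v \<and>
        holonomy_matrix (sections E) D (1, 0) v A1 \<and>
        holonomy_matrix (sections E) D (0, 1) v A2 \<and>
        G = generate SO_group {A1, A2})"


section \<open>The exterior square of a vector space\<close>

definition alternating_form :: "('e::real_vector \<Rightarrow> 'e \<Rightarrow> real) \<Rightarrow> bool" where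
  "alternating_form B \<longleftrightarrow> bilinear B \<and> (\<forall>x. B x x = 0)"

definition form_sum :: "('e::real_vector \<Rightarrow> 'e \<Rightarrow> real) \<Rightarrow> ('e \<times> 'e) list \<Rightarrow> real" where
  "form_sum B xs = (\<Sum>(x, y)\<leftarrow>xs. B x y)"

text \<open>A list of pairs \<open>(x, y)\<close> represents the sum of the bivectors \<open>x \<wedge> y\<close>. By the universal
  property, and because linear forms separate points, two such sums agree in the exterior
  square iff every alternating bilinear form takes the same value on them.\<close>

quotient_type (overloaded) 'e ext2 = "('e::real_vector \<times> 'e) list" /
    "\<lambda>xs ys. \<forall>B. alternating_form B \<longrightarrow> form_sum B xs = form_sum B ys"
  by (intro equivpI reflpI sympI transpI) auto

lift_definition wedge :: "'e::real_vector \<Rightarrow> 'e \<Rightarrow> 'e ext2" is "\<lambda>x y. [(x, y)]" .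

lemma form_sum_Nil: "form_sum B [] = 0"
  by (simp add: form_sum_def)

lemma form_sum_append: "form_sum B (xs @ ys) = form_sum B xs + form_sum B ys"
  by (simp add: form_sum_def)

lemma form_sum_scale:
  assumes "alternating_form B"
  shows "form_sum B (map (\<lambda>(x, y). (c *\<^sub>R x, y)) xs) = c * form_sum B xs"
proof -
  have "B (c *\<^sub>R x) y = c * B x y" for x y
    using assms bilinear_lmul[of B c x y] by (simp add: alternating_form_def)
  then show ?thesis
    by (induction xs) (auto simp: form_sum_def algebra_simps)
qed

instantiation ext2 :: (real_vector) real_vector
begin

lift_definition zero_ext2 :: "'a ext2" is "[]" .

lift_definition plus_ext2 :: "'a ext2 \<Rightarrow> 'a ext2 \<Rightarrow> 'a ext2" is append
  by (simp add: form_sum_append)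

lift_definition scaleR_ext2 :: "real \<Rightarrow> 'a ext2 \<Rightarrow> 'a ext2"
  is "\<lambda>c. map (\<lambda>(x, y). (c *\<^sub>R x, y))"
  by (simp add: form_sum_scale)

definition uminus_ext2 :: "'a ext2 \<Rightarrow> 'a ext2" where
  "uminus_ext2 a = (- 1) *\<^sub>R a"

definition minus_ext2 :: "'a ext2 \<Rightarrow> 'a ext2 \<Rightarrow> 'a ext2" where
  "minus_ext2 a b = a + - b"

instance
proof
  fix a b c :: "'a ext2" and r s :: real
  note sums = form_sum_Nil form_sum_append form_sum_scale
  show "a + b + c = a + (b + c)" by transfer (simp add: form_sum_append)
  show "a + b = b + a" by transfer (simp add: form_sum_append)
  show "0 + a = a" by transfer simp
  show "- a + a = 0" unfolding uminus_ext2_def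
    by transfer (intro allI impI, simp only: sums; simp)
  show "a - b = a + - b" by (simp add: minus_ext2_def)
  show "r *\<^sub>R (a + b) = r *\<^sub>R a + r *\<^sub>R b"
    by transfer (intro allI impI, simp only: sums; simp add: algebra_simps)
  show "(r + s) *\<^sub>R a = r *\<^sub>R a + s *\<^sub>R a"
    by transfer (intro allI impI, simp only: sums; simp add: algebra_simps)
  show "r *\<^sub>R s *\<^sub>R a = (r * s) *\<^sub>R a"
    by transfer (intro allI impI, simp only: sums; simp)
  show "1 *\<^sub>R a = a"
    by transfer (intro allI impI, simp only: sums; simp)
qed

end


section \<open>The exterior square of a bundle\<close>

text \<open>The exterior square of a subspace is identified with its image in that of the ambient
  space.\<close>

definition ext2_fibre :: "'e::real_vector vbundle \<Rightarrow> torus \<Rightarrow> 'e ext2 set" where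
  "ext2_fibre E p = span {wedge x y |x y. x \<in> fibre E p \<and> y \<in> fibre E p}"

definition ext2_sections ::
    "'e::real_vector vbundle \<Rightarrow> torus set \<Rightarrow> (torus \<Rightarrow> 'e ext2) set" where
  "ext2_sections E U = {\<omega>. (\<forall>p\<in>U. \<omega> p \<in> ext2_fibre E p) \<and>
     (\<forall>(V, e) \<in> frames E. \<exists>f. (\<forall>i j. torus_smooth_on (U \<inter> V) (f i j)) \<and>
        (\<forall>p \<in> U \<inter> V. \<omega> p = (\<Sum>i\<in>UNIV. \<Sum>j\<in>UNIV. f i j p *\<^sub>R wedge (e i p) (e j p))))}"

text \<open>The induced metric is the bilinear extension of
  \<open>(x \<wedge> y, x' \<wedge> y') \<mapsto> h(x, x') h(y, y') - h(x, y') h(y, x')\<close>.\<close>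

definition ext2_metric ::
    "'e::real_vector vbundle \<Rightarrow> (torus \<Rightarrow> 'e \<Rightarrow> 'e \<Rightarrow> real) \<Rightarrow>
     torus \<Rightarrow> 'e ext2 \<Rightarrow> 'e ext2 \<Rightarrow> real" where
  "ext2_metric E h p \<omega> \<eta> = (THE c. \<exists>(m::nat) (n::nat) x y x' y'.
     (\<forall>k<m. x k \<in> fibre E p \<and> y k \<in> fibre E p) \<and>
     (\<forall>l<n. x' l \<in> fibre E p \<and> y' l \<in> fibre E p) \<and>
     \<omega> = (\<Sum>k<m. wedge (x k) (y k)) \<and> \<eta> = (\<Sum>l<n. wedge (x' l) (y' l)) \<and>
     c = (\<Sum>k<m. \<Sum>l<n. h p (x k) (x' l) * h p (y k) (y' l) - h p (x k) (y' l) * h p (y k) (x' l)))"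

text \<open>The induced connection is given by the Leibniz rule
  \<open>D v (s \<wedge> t) = D v s \<wedge> t + s \<wedge> D v t\<close>; every smooth section of the exterior square is locally a sum
  of such products.\<close>

definition ext2_connection :: "'e::real_vector vbundle \<Rightarrow> 'e conn \<Rightarrow> 'e ext2 conn" where
  "ext2_connection E D v \<omega> p = (THE \<eta>. \<exists>U (n::nat) s t. torus_open U \<and> p \<in> U \<and>
     (\<forall>k<n. s k \<in> sections E U \<and> t k \<in> sections E U) \<and>
     (\<forall>q\<in>U. \<omega> q = (\<Sum>k<n. wedge (s k q) (t k q))) \<and>
     \<eta> = (\<Sum>k<n. wedge (D v (s k) p) (t k p) + wedge (s k p) (D v (t k) p)))"


section \<open>The (anti-)self-dual subbundles\<close>

datatype polarity = Plus | Minus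

primrec sgn_val :: "polarity \<Rightarrow> real" where
  "sgn_val Plus = 1"
| "sgn_val Minus = - 1"

definition Omega_frame :: "polarity \<Rightarrow> (4 \<Rightarrow> 'e::real_vector) \<Rightarrow> 3 \<Rightarrow> 'e ext2" where
  "Omega_frame \<epsilon> e k = (1 / sqrt 2) *\<^sub>R
     (if k = 1 then wedge (e 1) (e 2) + sgn_val \<epsilon> *\<^sub>R wedge (e 3) (e 4)
      else if k = 2 then wedge (e 1) (e 3) + sgn_val \<epsilon> *\<^sub>R wedge (e 4) (e 2)
      else wedge (e 1) (e 4) + sgn_val \<epsilon> *\<^sub>R wedge (e 2) (e 3))"

definition half_fibre ::
    "'e::real_vector vbundle \<Rightarrow> (torus \<Rightarrow> 'e \<Rightarrow> 'e \<Rightarrow> real) \<Rightarrow> polarity \<Rightarrow> torus \<Rightarrow> 'e ext2 set" where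
  "half_fibre E h \<epsilon> p = span {Omega_frame \<epsilon> e k |e k. positive_onb E h p e}"

definition half_sections ::
    "'e::real_vector vbundle \<Rightarrow> (torus \<Rightarrow> 'e \<Rightarrow> 'e \<Rightarrow> real) \<Rightarrow> polarity \<Rightarrow>
     torus set \<Rightarrow> (torus \<Rightarrow> 'e ext2) set" where
  "half_sections E h \<epsilon> U = {\<omega> \<in> ext2_sections E U. \<forall>p\<in>U. \<omega> p \<in> half_fibre E h \<epsilon> p}"

definition half_positive_onb ::
    "'e::real_vector vbundle \<Rightarrow> (torus \<Rightarrow> 'e \<Rightarrow> 'e \<Rightarrow> real) \<Rightarrow> polarity \<Rightarrow>
     torus \<Rightarrow> (3 \<Rightarrow> 'e ext2) \<Rightarrow> bool" where
  "half_positive_onb E h \<epsilon> p \<omega> \<longleftrightarrow>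
     (\<forall>i j. ext2_metric E h p (\<omega> i) (\<omega> j) = (if i = j then 1 else 0)) \<and>
     (\<exists>e (M :: real^3^3). positive_onb E h p e \<and> det M > 0 \<and>
        (\<forall>j. \<omega> j = (\<Sum>i\<in>UNIV. M $ i $ j *\<^sub>R Omega_frame \<epsilon> e i)))"

definition half_topological_holonomy_group ::
    "'e::real_vector vbundle \<Rightarrow> (torus \<Rightarrow> 'e \<Rightarrow> 'e \<Rightarrow> real) \<Rightarrow> 'e conn \<Rightarrow> polarity \<Rightarrow>
     (real^3^3) set \<Rightarrow> bool" where
  "half_topological_holonomy_group E h D \<epsilon> G \<longleftrightarrow>
     (\<exists>\<omega> C1 C2. half_positive_onb E h \<epsilon> (pr (0, 0)) \<omega> \<and>
        holonomy_matrix (half_sections E h \<epsilon>) (ext2_connection E D) (1, 0) \<omega> C1 \<and>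
        holonomy_matrix (half_sections E h \<epsilon>) (ext2_connection E D) (0, 1) \<omega> C2 \<and>
        G = generate SO_group {C1, C2})"

end

theory Submission
  imports Defs
begin

text \<open>
  A rotation \<open>A\<close> of an oriented Euclidean space of dimension 4 acts on bivectors and, commuting with the
  Hodge star, preserves the self-dual and the anti-self-dual bivectors. This gives two
  homomorphisms \<open>half_matrix Plus\<close> and \<open>half_matrix Minus\<close> from SO(4) to matrices of size 3, and
  jointly they determine \<open>A\<close> up to sign (\<open>half_matrices_determine_up_to_sign\<close>). A set of rotations
  is therefore finite if and only if both of its images are finite.

  It remains to see that, up to conjugation, \<open>half_matrix \<epsilon>\<close> maps the holonomy of the connection to
  that of the induced connection on the subbundle of polarity \<open>\<epsilon>\<close>. Let \<open>\<xi>\<close> be a parallel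
  orthonormal frame along an axis. By the Leibniz rule, a section of the exterior square is parallel
  if and only if its coefficients with respect to the bivectors \<open>\<xi> a \<wedge> \<xi> b\<close> are constant. So a
  parallel section of the subbundle keeps its coefficients with respect to the frame \<open>Omega_frame
  \<epsilon> \<xi>\<close> (\<open>parallel_half_section_coordinates\<close>), and one turn along the axis, which replaces \<open>\<xi>\<close> by
  \<open>\<xi> A\<close>, replaces \<open>Omega_frame \<epsilon> \<xi>\<close> by \<open>(Omega_frame \<epsilon> \<xi>) (half_matrix \<epsilon> A)\<close>
  (\<open>half_holonomy_conjugate\<close>).

  Coefficients are extracted by pairing with \<open>\<xi> a \<wedge> \<xi> b\<close> by means of the metric. The same pairing
  shows that the induced covariant derivative of a section does not depend on the decomposition
  of the section into products: along the axis, the pairing of the candidate value with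
  \<open>\<xi> a \<wedge> \<xi> b\<close> is the ordinary derivative of a coefficient of the section, and bivectors in a fibre
  are determined by these pairings (\<open>ext2_connection_DERIV\<close>).
\<close>

section \<open>Complementary minors of rotations in dimension 4\<close>

lemma det_4:
  "det (A::'a::comm_ring_1^4^4) =
    A$1$1 * A$2$2 * A$3$3 * A$4$4 - A$1$1 * A$2$2 * A$3$4 * A$4$3
  - A$1$1 * A$2$3 * A$3$2 * A$4$4 + A$1$1 * A$2$3 * A$3$4 * A$4$2
  + A$1$1 * A$2$4 * A$3$2 * A$4$3 - A$1$1 * A$2$4 * A$3$3 * A$4$2
  - A$1$2 * A$2$1 * A$3$3 * A$4$4 + A$1$2 * A$2$1 * A$3$4 * A$4$3
  + A$1$2 * A$2$3 * A$3$1 * A$4$4 - A$1$2 * A$2$3 * A$3$4 * A$4$1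
  - A$1$2 * A$2$4 * A$3$1 * A$4$3 + A$1$2 * A$2$4 * A$3$3 * A$4$1
  + A$1$3 * A$2$1 * A$3$2 * A$4$4 - A$1$3 * A$2$1 * A$3$4 * A$4$2
  - A$1$3 * A$2$2 * A$3$1 * A$4$4 + A$1$3 * A$2$2 * A$3$4 * A$4$1
  + A$1$3 * A$2$4 * A$3$1 * A$4$2 - A$1$3 * A$2$4 * A$3$2 * A$4$1
  - A$1$4 * A$2$1 * A$3$2 * A$4$3 + A$1$4 * A$2$1 * A$3$3 * A$4$2
  + A$1$4 * A$2$2 * A$3$1 * A$4$3 - A$1$4 * A$2$2 * A$3$3 * A$4$1
  - A$1$4 * A$2$3 * A$3$1 * A$4$2 + A$1$4 * A$2$3 * A$3$2 * A$4$1"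
proof -
  have f1: "finite {2::4, 3, 4}" "1 \<notin> {2::4, 3, 4}" by auto
  have f2: "finite {3::4, 4}" "2 \<notin> {3::4, 4}" by auto
  have f3: "finite {4::4}" "3 \<notin> {4::4}" by auto
  show ?thesis
    unfolding det_def UNIV_4
    unfolding sum_over_permutations_insert[OF f1]
    unfolding sum_over_permutations_insert[OF f2]
    unfolding sum_over_permutations_insert[OF f3]
    unfolding permutes_sing
    by (simp add: sign_swap_id permutation_swap_id permutation_compose sign_compose sign_id swap_id_eq algebra_simps)
qed

definition minor2 :: "real^'n^'m \<Rightarrow> 'm \<Rightarrow> 'm \<Rightarrow> 'n \<Rightarrow> 'n \<Rightarrow> real" where
  "minor2 A i j k l = A $ i $ k * A $ j $ l - A $ i $ l * A $ j $ k"

abbreviation SO :: "(real^'n^'n) set" where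
  "SO \<equiv> carrier SO_group"

lemma SO_iff: "A \<in> SO \<longleftrightarrow> orthogonal_matrix A \<and> det A = 1"
  by (simp add: SO_group_def)

lemma SO_rows:
  assumes "A \<in> SO"
  shows "(\<Sum>k\<in>UNIV. A $ i $ k * A $ j $ k) = (if i = j then 1 else 0)"
proof -
  have "A ** transpose A = mat 1"
    using assms by (simp add: SO_iff orthogonal_matrix_def)
  then have "(A ** transpose A) $ i $ j = mat 1 $ i $ j" by simp
  then show ?thesis by (simp add: matrix_matrix_mult_def transpose_def mat_def)
qed

text \<open>Write \<open>A\<close> in blocks \<open>X, Y, Z, W\<close> of size 2. The rows of \<open>A\<close> are orthonormal, so multiplying \<open>A\<close> by
the block triangular matrix with rows \<open>1, Z\<^sup>T\<close> and \<open>0, W\<^sup>T\<close> gives the block triangular matrix with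
rows \<open>X, 0\<close> and \<open>Z, 1\<close>. Taking determinants, \<open>det A * det W = det X\<close>.\<close>

lemma SO4_upper_lower_minor:
  fixes A :: "real^4^4"
  assumes A: "A \<in> SO"
  shows "minor2 A 1 2 1 2 = minor2 A 3 4 3 4"
proof -
  \<comment> \<open>the block triangular factor with rows \<open>1, Z\<^sup>T\<close> and \<open>0, W\<^sup>T\<close>\<close>
  define B :: "real^4^4" where
    "B = (\<chi> i j. if j = 3 \<or> j = 4 then A $ j $ i else if i = j then 1 else 0)"
  have "det (A ** B) = det A * det B" by (rule det_mul)
  moreover have "det A = 1" using A by (simp add: SO_iff)
  moreover have "det B = minor2 A 3 4 3 4"
    by (simp add: det_4 B_def minor2_def)
  moreover have "det (A ** B) = minor2 A 1 2 1 2"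
  proof -
    have "(A ** B) $ i $ j = (if j = 3 \<or> j = 4 then if i = j then 1 else 0 else A $ i $ j)" for i j
    proof (cases "j = 3 \<or> j = 4")
      case True
      then have "(A ** B) $ i $ j = (\<Sum>k\<in>UNIV. A $ i $ k * A $ j $ k)"
        by (simp add: matrix_matrix_mult_def B_def)
      with True show ?thesis by (simp add: SO_rows[OF A])
    next
      case False
      then have "(A ** B) $ i $ j = (\<Sum>k\<in>UNIV. if k = j then A $ i $ k else 0)"
        unfolding matrix_matrix_mult_def B_def vec_lambda_beta by (intro sum.cong) auto
      with False show ?thesis by simp
    qed
    then show ?thesis by (simp add: det_4 minor2_def)
  qed
  ultimately show ?thesis by simp
qed

text \<open>Permuting rows and columns by permutations of equal sign moves a pair of complementary minors
to the corners treated in the previous lemma.\<close>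

lemma SO_permute:
  fixes A :: "real^'n^'n"
  assumes A: "A \<in> SO" and p: "bij p" and q: "bij q"
    and s: "sign p = sign q"
  shows "(\<chi> i j. A $ p i $ q j) \<in> SO"
proof -
  have p': "p permutes UNIV" and q': "q permutes UNIV"
    using p q bij_imp_permutes by auto
  have "det (\<chi> i j. A $ p i $ q j) = of_int (sign p) * (of_int (sign q) * det A)"
    using det_permute_rows[OF p', of "\<chi> i j. A $ i $ q j"]
      det_permute_columns[OF q', of A] by simp
  also have "\<dots> = 1"
    using A s by (simp add: SO_iff sign_def)
  finally have d: "det (\<chi> i j. A $ p i $ q j) = 1" .
  have "(\<chi> i j. A $ p i $ q j) ** transpose (\<chi> i j. A $ p i $ q j) = mat 1"
  proof -
    have "(\<Sum>k\<in>UNIV. A $ p i $ q k * A $ p j $ q k) = (if i = j then 1 else 0)" for i j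
      using sum.reindex_bij_betw[OF q, of "\<lambda>k. A $ p i $ k * A $ p j $ k"]
        SO_rows[OF A] p by (simp add: inj_eq bij_is_inj)
    then show ?thesis by (simp add: vec_eq_iff matrix_matrix_mult_def transpose_def mat_def)
  qed
  then have "orthogonal_matrix (\<chi> i j. A $ p i $ q j)"
    using matrix_left_right_inverse by (auto simp: orthogonal_matrix_def)
  with d show ?thesis by (simp add: SO_iff)
qed

lemma SO4_complementary_minor:
  fixes A :: "real^4^4"
  assumes A: "A \<in> SO" and "bij p" "bij q" "sign p = sign q"
  shows "minor2 A (p 1) (p 2) (q 1) (q 2) = minor2 A (p 3) (p 4) (q 3) (q 4)"
  using SO4_upper_lower_minor[OF SO_permute[OF assms]] by (simp add: minor2_def)

text \<open>The even permutations \<open>rot k\<close> fix 1 and rotate 2, 3, 4. They enumerate the bivectors in the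
definition of \<^const>\<open>Omega_frame\<close>: its \<open>k\<close>-th member is built from \<open>e\<^sub>1 \<wedge> e\<^bsub>rot k 2\<^esub>\<close> and
\<open>e\<^bsub>rot k 3\<^esub> \<wedge> e\<^bsub>rot k 4\<^esub>\<close>.\<close>

definition rot :: "3 \<Rightarrow> 4 \<Rightarrow> 4" where
  "rot k = (if k = 1 then id
    else if k = 2 then Transposition.transpose 2 3 \<circ> Transposition.transpose 3 4
    else Transposition.transpose 2 4 \<circ> Transposition.transpose 3 4)"

definition swap_halves :: "4 \<Rightarrow> 4" where
  "swap_halves = Transposition.transpose 1 3 \<circ> Transposition.transpose 2 4"

lemma rot_simps [simp]:
  "rot 1 = id" "rot k 1 = 1"
  "rot 2 2 = 3" "rot 2 3 = 4" "rot 2 4 = 2"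
  "rot 3 2 = 4" "rot 3 3 = 2" "rot 3 4 = 3"
  by (simp_all add: rot_def)

lemma swap_halves_simps [simp]:
  "swap_halves 1 = 3" "swap_halves 2 = 4" "swap_halves 3 = 1" "swap_halves 4 = 2"
  by (simp_all add: swap_halves_def)

lemma bij_rot: "bij (rot k)" and sign_rot: "sign (rot k) = 1"
  by (simp_all add: rot_def bij_comp sign_compose permutation_swap_id sign_swap_id sign_id)

lemma bij_swap_halves: "bij swap_halves" and sign_swap_halves: "sign swap_halves = 1"
  by (simp_all add: swap_halves_def bij_comp sign_compose permutation_swap_id sign_swap_id)

text \<open>In coordinates, this says that the action of a rotation on bivectors commutes with the Hodge
star, which exchanges the two bivectors attached to \<open>rot k\<close>.\<close>

lemma SO4_minor_hodge:
  fixes A :: "real^4^4"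
  assumes A: "A \<in> SO"
  shows "minor2 A (rot k 3) (rot k 4) (rot l 3) (rot l 4) = minor2 A 1 (rot k 2) 1 (rot l 2)"
    and "minor2 A (rot k 3) (rot k 4) 1 (rot l 2) = minor2 A 1 (rot k 2) (rot l 3) (rot l 4)"
proof -
  show "minor2 A (rot k 3) (rot k 4) (rot l 3) (rot l 4) = minor2 A 1 (rot k 2) 1 (rot l 2)"
    using SO4_complementary_minor[OF A bij_rot bij_rot, of k l] by (simp add: sign_rot)
  have "sign (rot l \<circ> swap_halves) = 1"
    using sign_compose[of "rot l" swap_halves] bij_rot bij_swap_halves
    by (simp add: sign_rot sign_swap_halves permutation)
  then show "minor2 A (rot k 3) (rot k 4) 1 (rot l 2) = minor2 A 1 (rot k 2) (rot l 3) (rot l 4)"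
    using SO4_complementary_minor[OF A bij_rot bij_comp[OF bij_swap_halves bij_rot], of k l]
    by (simp add: sign_rot)
qed

section \<open>The action of rotations on self-dual and anti-self-dual bivectors\<close>

text \<open>The matrix by which a rotation transforms \<^const>\<open>Omega_frame\<close>, see \<open>Omega_frame_change\<close>.\<close>

definition half_matrix :: "polarity \<Rightarrow> real^4^4 \<Rightarrow> real^3^3" where
  "half_matrix \<epsilon> A = (\<chi> k l. minor2 A 1 (rot k 2) 1 (rot l 2)
     + sgn_val \<epsilon> * minor2 A 1 (rot k 2) (rot l 3) (rot l 4))"

lemma half_matrix_nth:
  "half_matrix \<epsilon> A $ k $ l = minor2 A 1 (rot k 2) 1 (rot l 2)
     + sgn_val \<epsilon> * minor2 A 1 (rot k 2) (rot l 3) (rot l 4)"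
  by (simp add: half_matrix_def)

lemma ex_third_index: "\<exists>j::4. j \<noteq> i \<and> j \<noteq> k"
proof -
  have "card {i, k} < CARD(4)" by (simp add: card_insert_if)
  then have "{i, k} \<noteq> (UNIV :: 4 set)" by (metis less_irrefl)
  then show ?thesis by auto
qed

text \<open>If \<open>S\<close> acts trivially on bivectors, it maps every plane spanned by two coordinate vectors to itself,
hence also every coordinate axis, as the intersection of such planes. So \<open>S\<close> is diagonal, and any two of
its diagonal entries have product 1.\<close>

lemma minors_trivial_imp_scalar:
  fixes S :: "real^4^4"
  assumes m: "\<And>i j k l. minor2 S i j k l = minor2 (mat 1) i j k l"
  shows "S = mat 1 \<or> S = - mat 1"
proof -
  have off: "S $ k $ i = 0" if "k \<noteq> i" for k i
  proof -
    obtain j where j: "j \<noteq> i" "j \<noteq> k" using ex_third_index by blast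
    \<comment> \<open>expansion of a \<open>3 \<times> 3\<close> determinant with a repeated column\<close>
    have "S $ k $ i * minor2 S i j i j - S $ i $ i * minor2 S k j i j + S $ j $ i * minor2 S k i i j = 0"
      by (simp add: minor2_def algebra_simps)
    then show ?thesis
      unfolding m using that j by (simp add: minor2_def mat_def)
  qed
  have diag: "S $ i $ i * S $ j $ j = 1" if "i \<noteq> j" for i j
    using m[of i j i j] that off[of i j] by (simp add: minor2_def mat_def)
  have "S $ i $ i = S $ 1 $ 1" for i
  proof -
    obtain j where j: "j \<noteq> i" "j \<noteq> 1" using ex_third_index by blast
    have "S $ i $ i * S $ j $ j = S $ 1 $ 1 * S $ j $ j" using diag j by metis
    moreover have "S $ j $ j \<noteq> 0" using diag[of 1 j] j by auto
    ultimately show ?thesis by simp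
  qed
  moreover have "S $ 1 $ 1 = 1 \<or> S $ 1 $ 1 = -1"
    using diag[of 1 2] calculation[of 2] by (simp add: square_eq_1_iff)
  ultimately show ?thesis
    using off by (auto simp: vec_eq_iff mat_def)
qed

lemma minor2_antisym:
  "minor2 A i i k l = 0" "minor2 A i j k k = 0"
  "minor2 A j i k l = - minor2 A i j k l" "minor2 A i j l k = - minor2 A i j k l"
  by (simp_all add: minor2_def)

text \<open>The sum and the difference of the two matrices give the minors whose rows include
the first one, and
\<open>SO4_minor_hodge\<close> gives the remaining ones.\<close>

lemma half_matrices_determine_minors:
  fixes A B :: "real^4^4"
  assumes A: "A \<in> SO" and B: "B \<in> SO" and eq: "\<And>\<epsilon>. half_matrix \<epsilon> A = half_matrix \<epsilon> B"
  shows "minor2 A i j k l = minor2 B i j k l"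
proof -
  \<comment> \<open>one orientation for each of the six pairs of indices; antisymmetry gives the other one\<close>
  define S :: "(4 \<times> 4) set" where
    "S = range (\<lambda>m. (1, rot m 2)) \<union> range (\<lambda>m. (rot m 3, rot m 4))"
  have first: "minor2 A 1 (rot k 2) 1 (rot l 2) = minor2 B 1 (rot k 2) 1 (rot l 2)"
    "minor2 A 1 (rot k 2) (rot l 3) (rot l 4) = minor2 B 1 (rot k 2) (rot l 3) (rot l 4)" for k l
  proof -
    have "half_matrix Plus A $ k $ l = half_matrix Plus B $ k $ l"
      "half_matrix Minus A $ k $ l = half_matrix Minus B $ k $ l"
      by (simp_all add: eq)
    then show "minor2 A 1 (rot k 2) 1 (rot l 2) = minor2 B 1 (rot k 2) 1 (rot l 2)"
      "minor2 A 1 (rot k 2) (rot l 3) (rot l 4) = minor2 B 1 (rot k 2) (rot l 3) (rot l 4)"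
      unfolding half_matrix_nth sgn_val.simps by linarith+
  qed
  have base: "minor2 A i j k l = minor2 B i j k l" if "(i, j) \<in> S" "(k, l) \<in> S" for i j k l
    using that unfolding S_def
    by (auto simp: first SO4_minor_hodge[OF A] SO4_minor_hodge[OF B])
  have pairs: "i = j \<or> (i, j) \<in> S \<or> (j, i) \<in> S" for i j
  proof -
    have "S = {(1, 2), (1, 3), (1, 4), (3, 4), (4, 2), (2, 3)}"
      unfolding S_def UNIV_3 by auto
    then show ?thesis using exhaust_4[of i] exhaust_4[of j] by auto
  qed
  show ?thesis
    using pairs[of i j] pairs[of k l] base[of i j k l] base[of j i k l] base[of i j l k] base[of j i l k]
    by (auto simp: minor2_antisym(1,2) minor2_antisym(3)[of _ j i] minor2_antisym(4)[of _ _ _ l k])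
qed

text \<open>Alternating forms induce linear functionals on the exterior square, and these separate its points
(\<open>ext2_eqI\<close>), so that identities between bivectors reduce to identities between real numbers.
A form that is not alternating gets the value 0, only to make the function total.\<close>

lift_definition ext2_eval :: "('e::real_vector \<Rightarrow> 'e \<Rightarrow> real) \<Rightarrow> 'e ext2 \<Rightarrow> real" is
  "\<lambda>B xs. if alternating_form B then form_sum B xs else 0"
  by auto

lemma ext2_eqI:
  assumes "\<And>B. alternating_form B \<Longrightarrow> ext2_eval B z = ext2_eval B w"
  shows "z = w"
  using assms by transfer simp

lemma ext2_eval_wedge [simp]: "alternating_form B \<Longrightarrow> ext2_eval B (wedge x y) = B x y"
  by transfer (simp add: form_sum_def)

lemma linear_ext2_eval: "linear (ext2_eval B)"
proof (rule linearI)
  show "ext2_eval B (z + w) = ext2_eval B z + ext2_eval B w" for z w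
    by transfer (simp add: form_sum_append)
  show "ext2_eval B (c *\<^sub>R z) = c *\<^sub>R ext2_eval B z" for c z
    by transfer (simp add: form_sum_scale)
qed

lemmas ext2_eval_simps [simp] =
  linear_0[OF linear_ext2_eval] linear_add[OF linear_ext2_eval] linear_diff[OF linear_ext2_eval]
  linear_cmul[OF linear_ext2_eval] linear_sum[OF linear_ext2_eval]

lemma alternating_formD:
  assumes "alternating_form B"
  shows "linear (B x)" "linear (\<lambda>x. B x y)" "B x x = 0" "B y x = - B x y"
proof -
  show *: "linear (B x)" "linear (\<lambda>x. B x y)" "B x x = 0" for x y
    using assms by (simp_all add: alternating_form_def bilinear_def)
  have "B (x + y) (x + y) = B x x + B x y + B y x + B y y"
    by (simp add: linear_add[OF *(1)] linear_add[OF *(2)])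
  then show "B y x = - B x y" by (simp add: *(3))
qed

lemma bilinear_wedge: "bilinear wedge"
  unfolding bilinear_def
  by (auto intro!: linearI ext2_eqI simp: linear_add[OF alternating_formD(1)]
    linear_add[OF alternating_formD(2)] linear_cmul[OF alternating_formD(1)]
    linear_cmul[OF alternating_formD(2)])

text \<open>The coefficients of the wedge product of two columns of \<open>A\<close> in the basis of bivectors enumerated by
\<open>rot\<close> are the minors of \<open>A\<close>.\<close>

lemma alternating_form_comb:
  fixes v :: "4 \<Rightarrow> 'e::real_vector"
  assumes B: "alternating_form B"
  shows "B (\<Sum>i\<in>UNIV. A $ i $ k *\<^sub>R v i) (\<Sum>i\<in>UNIV. A $ i $ l *\<^sub>R v i) =
    (\<Sum>m\<in>(UNIV::3 set). minor2 A 1 (rot m 2) k l * B (v 1) (v (rot m 2))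
       + minor2 A (rot m 3) (rot m 4) k l * B (v (rot m 3)) (v (rot m 4)))"
proof -
  note L = alternating_formD(1,2)[OF B]
  note anti = alternating_formD(4)[OF B, of "v 1" "v 2"] alternating_formD(4)[OF B, of "v 1" "v 3"]
    alternating_formD(4)[OF B, of "v 1" "v 4"] alternating_formD(4)[OF B, of "v 2" "v 3"]
    alternating_formD(4)[OF B, of "v 3" "v 4"] alternating_formD(4)[OF B, of "v 4" "v 2"]
  have "B (\<Sum>i\<in>UNIV. A $ i $ k *\<^sub>R v i) (\<Sum>i\<in>UNIV. A $ i $ l *\<^sub>R v i) =
     (\<Sum>j\<in>UNIV. \<Sum>i\<in>UNIV. A $ i $ k * A $ j $ l * B (v i) (v j))"
    by (simp add: linear_sum[OF L(1)] linear_sum[OF L(2)] linear_cmul[OF L(1)] linear_cmul[OF L(2)]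
        sum_distrib_left mult_ac)
  then show ?thesis
    by (simp add: sum_4 sum_3 anti alternating_formD(3)[OF B] minor2_def algebra_simps)
qed

lemma Omega_frame_rot:
  "Omega_frame \<epsilon> e k = (1 / sqrt 2) *\<^sub>R
     (wedge (e 1) (e (rot k 2)) + sgn_val \<epsilon> *\<^sub>R wedge (e (rot k 3)) (e (rot k 4)))"
  using exhaust_3[of k] by (auto simp: Omega_frame_def)

lemma sgn_val_square [simp]: "sgn_val \<epsilon> * sgn_val \<epsilon> = 1"
  by (cases \<epsilon>) simp_all

text \<open>By the Hodge symmetry of the minors, the coefficients of the transformed bivector at
\<open>v\<^bsub>rot k 3\<^esub> \<wedge> v\<^bsub>rot k 4\<^esub>\<close> are those at \<open>v\<^sub>1 \<wedge> v\<^bsub>rot k 2\<^esub>\<close> up to the sign of \<open>\<epsilon>\<close>.\<close>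

lemma Omega_frame_change:
  fixes v :: "4 \<Rightarrow> 'e::real_vector"
  assumes A: "A \<in> SO"
  shows "Omega_frame \<epsilon> (\<lambda>j. \<Sum>i\<in>UNIV. A $ i $ j *\<^sub>R v i) l =
    (\<Sum>k\<in>UNIV. half_matrix \<epsilon> A $ k $ l *\<^sub>R Omega_frame \<epsilon> v k)"
proof (rule ext2_eqI)
  fix B :: "'e \<Rightarrow> 'e \<Rightarrow> real"
  assume B: "alternating_form B"
  have *: "minor2 A (rot k 3) (rot k 4) 1 (rot l 2) + sgn_val \<epsilon> * minor2 A (rot k 3) (rot k 4) (rot l 3) (rot l 4)
     = sgn_val \<epsilon> * half_matrix \<epsilon> A $ k $ l" for k
    by (simp add: SO4_minor_hodge[OF A] half_matrix_nth algebra_simps mult.assoc[symmetric])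
  let ?X = "\<lambda>k. B (v 1) (v (rot k 2))" and ?Y = "\<lambda>k. B (v (rot k 3)) (v (rot k 4))"
  have "ext2_eval B (Omega_frame \<epsilon> (\<lambda>j. \<Sum>i\<in>UNIV. A $ i $ j *\<^sub>R v i) l) =
    (1 / sqrt 2) * ((\<Sum>k\<in>UNIV. minor2 A 1 (rot k 2) 1 (rot l 2) * ?X k
        + minor2 A (rot k 3) (rot k 4) 1 (rot l 2) * ?Y k)
      + sgn_val \<epsilon> * (\<Sum>k\<in>UNIV. minor2 A 1 (rot k 2) (rot l 3) (rot l 4) * ?X k
        + minor2 A (rot k 3) (rot k 4) (rot l 3) (rot l 4) * ?Y k))"
    unfolding Omega_frame_rot by (simp add: B alternating_form_comb[OF B])
  also have "\<dots> = (1 / sqrt 2) * (\<Sum>k\<in>UNIV. half_matrix \<epsilon> A $ k $ l * ?X k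
      + (minor2 A (rot k 3) (rot k 4) 1 (rot l 2)
          + sgn_val \<epsilon> * minor2 A (rot k 3) (rot k 4) (rot l 3) (rot l 4)) * ?Y k)"
    unfolding half_matrix_nth by (simp add: sum_distrib_left sum.distrib algebra_simps)
  also have "\<dots> = (1 / sqrt 2) * (\<Sum>k\<in>UNIV. half_matrix \<epsilon> A $ k $ l * ?X k
      + sgn_val \<epsilon> * half_matrix \<epsilon> A $ k $ l * ?Y k)"
    unfolding * ..
  also have "\<dots> = ext2_eval B (\<Sum>k\<in>UNIV. half_matrix \<epsilon> A $ k $ l *\<^sub>R Omega_frame \<epsilon> v k)"
    unfolding Omega_frame_rot
    by (simp add: B sum_distrib_left algebra_simps)
  finally show "ext2_eval B (Omega_frame \<epsilon> (\<lambda>j. \<Sum>i\<in>UNIV. A $ i $ j *\<^sub>R v i) l) =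
    ext2_eval B (\<Sum>k\<in>UNIV. half_matrix \<epsilon> A $ k $ l *\<^sub>R Omega_frame \<epsilon> v k)" .
qed

text \<open>The wedge product of two linear functionals, as an alternating form.\<close>

definition coform :: "('e \<Rightarrow> real) \<Rightarrow> ('e \<Rightarrow> real) \<Rightarrow> 'e \<Rightarrow> 'e \<Rightarrow> real" where
  "coform f g x y = f x * g y - g x * f y"

lemma alternating_coform:
  assumes "linear f" "linear g"
  shows "alternating_form (coform f g)"
  unfolding alternating_form_def bilinear_def coform_def
  using assms by (auto intro!: linearI simp: linear_add linear_cmul algebra_simps)

lemma coform_Omega_frame:
  fixes f :: "4 \<Rightarrow> 'e::real_vector \<Rightarrow> real"
  assumes f: "\<And>a. linear (f a)" and fv: "\<And>a b. f a (v b) = (if a = b then 1 else 0)"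
  shows "ext2_eval (coform (f 1) (f (rot l 2))) (Omega_frame \<epsilon> v k) = (if k = l then 1 / sqrt 2 else 0)"
  unfolding Omega_frame_rot
  using exhaust_3[of k] exhaust_3[of l]
  by (auto simp: alternating_coform[OF f f]) (simp_all add: coform_def fv)

text \<open>\<^const>\<open>Omega_frame\<close> is linearly independent if \<open>v\<close> has a dual family \<open>f\<close>: the form
\<open>f\<^sub>1 \<wedge> f\<^bsub>rot l 2\<^esub>\<close> vanishes on all members of the frame but the \<open>l\<close>-th.\<close>

lemma Omega_frame_coeffs_eq:
  fixes f :: "4 \<Rightarrow> 'e::real_vector \<Rightarrow> real"
  assumes f: "\<And>a. linear (f a)" and fv: "\<And>a b. f a (v b) = (if a = b then 1 else 0)"
    and eq: "(\<Sum>k\<in>UNIV. c k *\<^sub>R Omega_frame \<epsilon> v k) = (\<Sum>k\<in>UNIV. d k *\<^sub>R Omega_frame \<epsilon> v k)"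
  shows "c l = d l"
proof -
  let ?e = "ext2_eval (coform (f 1) (f (rot l 2)))"
  have "?e (\<Sum>k\<in>UNIV. c k *\<^sub>R Omega_frame \<epsilon> v k) = c l / sqrt 2" for c
    by (simp add: coform_Omega_frame[OF f fv] if_distrib[of "(*) _"] cong: if_cong)
  from this[of c] this[of d] show ?thesis by (simp add: eq)
qed

lemma half_matrix_one: "half_matrix \<epsilon> (mat 1) = mat 1"
  unfolding vec_eq_iff forall_3 half_matrix_nth by (simp add: minor2_def mat_def)

lemma matrix_comb_comb:
  fixes v :: "'a::finite \<Rightarrow> 'e::real_vector" and A :: "real^'b^'a" and B :: "real^'c^'b"
  shows "(\<Sum>j\<in>UNIV. B $ j $ k *\<^sub>R (\<Sum>i\<in>UNIV. A $ i $ j *\<^sub>R v i)) = (\<Sum>i\<in>UNIV. (A ** B) $ i $ k *\<^sub>R v i)"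
proof -
  have "(\<Sum>j\<in>UNIV. B $ j $ k *\<^sub>R (\<Sum>i\<in>UNIV. A $ i $ j *\<^sub>R v i))
     = (\<Sum>j\<in>UNIV. \<Sum>i\<in>UNIV. (A $ i $ j * B $ j $ k) *\<^sub>R v i)"
    by (simp add: scaleR_sum_right mult.commute)
  also have "\<dots> = (\<Sum>i\<in>UNIV. \<Sum>j\<in>UNIV. (A $ i $ j * B $ j $ k) *\<^sub>R v i)"
    by (rule sum.swap)
  finally show ?thesis
    by (simp add: matrix_matrix_mult_def scaleR_sum_left)
qed

lemma SO_mult: "A \<in> SO \<Longrightarrow> B \<in> SO \<Longrightarrow> A ** B \<in> SO"
  by (simp add: SO_iff orthogonal_matrix_mul det_mul)

lemma SO_transpose: "A \<in> SO \<Longrightarrow> transpose A \<in> SO"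
  by (simp add: SO_iff orthogonal_matrix_transpose)

lemma SO_one: "mat 1 \<in> SO"
  by (simp add: SO_iff orthogonal_matrix_id)

text \<open>Change the standard basis by \<open>A\<close> and then by \<open>B\<close>, and compare coefficients.\<close>

lemma half_matrix_mult:
  assumes A: "A \<in> SO" and B: "B \<in> SO"
  shows "half_matrix \<epsilon> (A ** B) = half_matrix \<epsilon> A ** half_matrix \<epsilon> B"
proof -
  define v :: "4 \<Rightarrow> real^4" where "v i = axis i 1" for i
  have lin: "linear (\<lambda>x::real^4. x $ a)" for a by (auto intro!: linearI)
  have dual: "v b $ a = (if a = b then 1 else 0)" for a b by (simp add: v_def axis_def)
  have "(\<Sum>k\<in>UNIV. half_matrix \<epsilon> (A ** B) $ k $ l *\<^sub>R Omega_frame \<epsilon> v k) =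
      (\<Sum>k\<in>UNIV. (half_matrix \<epsilon> A ** half_matrix \<epsilon> B) $ k $ l *\<^sub>R Omega_frame \<epsilon> v k)" for l
    unfolding Omega_frame_change[OF SO_mult[OF A B], symmetric] matrix_comb_comb[symmetric]
      Omega_frame_change[OF A, symmetric] Omega_frame_change[OF B, symmetric] ..
  from Omega_frame_coeffs_eq[OF lin dual this] show ?thesis by (simp add: vec_eq_iff)
qed

text \<open>The rotation \<open>B\<^sup>T A\<close> acts on bivectors like the identity.\<close>

lemma half_matrices_determine_up_to_sign:
  assumes A: "A \<in> SO" and B: "B \<in> SO" and eq: "\<And>\<epsilon>. half_matrix \<epsilon> A = half_matrix \<epsilon> B"
  shows "A = B \<or> A = - B"
proof -
  let ?S = "transpose B ** A"
  have S: "?S \<in> SO" by (intro SO_mult SO_transpose A B)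
  have BB: "transpose B ** B = mat 1" "B ** transpose B = mat 1"
    using B by (simp_all add: SO_iff orthogonal_matrix_def)
  have "half_matrix \<epsilon> ?S = half_matrix \<epsilon> (transpose B ** B)" for \<epsilon>
    using half_matrix_mult SO_transpose A B by (metis eq)
  then have "half_matrix \<epsilon> ?S = half_matrix \<epsilon> (mat 1)" for \<epsilon>
    by (simp add: BB)
  from half_matrices_determine_minors[OF S SO_one this]
  have "?S = mat 1 \<or> ?S = - mat 1" by (rule minors_trivial_imp_scalar)
  moreover have "B ** ?S = A" by (simp add: matrix_mul_assoc BB)
  moreover have "B ** (- mat 1) = - B"
    by (simp add: vec_eq_iff matrix_matrix_mult_def mat_def if_distrib[of "(*) _"] if_distrib[of uminus] sum_negf cong: if_cong)
  ultimately show ?thesis by (metis matrix_mul_rid)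
qed

lemma half_matrix_transpose_mult:
  "A \<in> SO \<Longrightarrow> half_matrix \<epsilon> (transpose A) ** half_matrix \<epsilon> A = mat 1"
  by (metis SO_iff SO_transpose half_matrix_mult half_matrix_one orthogonal_matrix_def)

section \<open>Smooth functions on the torus and on lines\<close>

lemma Ck_on_subset: "Ck_on k S f \<Longrightarrow> T \<subseteq> S \<Longrightarrow> Ck_on k T f"
  by (induction k arbitrary: f) (auto intro: continuous_on_subset)

lemma Ck_on_Suc_imp: "Ck_on (Suc k) S f \<Longrightarrow> Ck_on k S f"
proof (induction k arbitrary: f)
  case 0
  then show ?case
    by (auto intro!: continuous_at_imp_continuous_on differentiable_imp_continuous_within)
next
  case (Suc k)
  then show ?case by simp
qed

lemma Ck_on_cong:
  assumes "open S" "\<And>x. x \<in> S \<Longrightarrow> f x = g x" "Ck_on k S f"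
  shows "Ck_on k S g"
  using assms(2,3)
proof (induction k arbitrary: f g)
  case 0
  then show ?case by (simp cong: continuous_on_cong)
next
  case (Suc k)
  have der: "(g has_derivative frechet_derivative f (at x)) (at x)" if "x \<in> S" for x
  proof (rule has_derivative_transform_within_open)
    show "(f has_derivative frechet_derivative f (at x)) (at x)"
      using Suc.prems(2) that by (simp add: frechet_derivative_works[symmetric])
  qed (use assms(1) that Suc.prems(1) in auto)
  then have "frechet_derivative f (at x) v = frechet_derivative g (at x) v" if "x \<in> S" for x v
    using that by (metis frechet_derivative_at)
  then have "Ck_on k S (\<lambda>x. frechet_derivative g (at x) v)" for v
    using Suc.IH Suc.prems(2) by (metis (no_types, lifting) Ck_on.simps(2))
  moreover have "g differentiable at x" if "x \<in> S" for x
    using der[OF that] by (auto simp: differentiable_def)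
  ultimately show ?case by simp
qed

lemma Ck_on_const: "Ck_on k S (\<lambda>x. c)"
proof (induction k arbitrary: c)
  case 0
  then show ?case by simp
next
  case (Suc k)
  then show ?case by (simp add: frechet_derivative_const)
qed

lemma Ck_on_add:
  assumes "open S" "Ck_on k S f" "Ck_on k S g"
  shows "Ck_on k S (\<lambda>x. f x + g x)"
  using assms(2,3)
proof (induction k arbitrary: f g)
  case 0
  then show ?case by (auto intro: continuous_intros)
next
  case (Suc k)
  have der: "frechet_derivative f (at x) v + frechet_derivative g (at x) v
      = frechet_derivative (\<lambda>x. f x + g x) (at x) v" if "x \<in> S" for x v
  proof -
    have "(f has_derivative frechet_derivative f (at x)) (at x)"
      "(g has_derivative frechet_derivative g (at x)) (at x)"
      using Suc.prems that by (simp_all add: frechet_derivative_works[symmetric])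
    from fun_cong[OF frechet_derivative_at[OF has_derivative_add[OF this]]] show ?thesis .
  qed
  have ck: "Ck_on k S (\<lambda>x. frechet_derivative f (at x) v + frechet_derivative g (at x) v)" for v
    using Suc by simp
  have "Ck_on k S (\<lambda>x. frechet_derivative (\<lambda>x. f x + g x) (at x) v)" for v
    by (rule Ck_on_cong[OF assms(1) der ck])
  with Suc.prems show ?case by simp
qed

lemma Ck_on_mult:
  assumes "open S" "Ck_on k S f" "Ck_on k S g"
  shows "Ck_on k S (\<lambda>x. f x * g x)"
  using assms(2,3)
proof (induction k arbitrary: f g)
  case 0
  then show ?case by (auto intro: continuous_intros)
next
  case (Suc k)
  have ck: "Ck_on k S (\<lambda>x. f x * frechet_derivative g (at x) v + frechet_derivative f (at x) v * g x)" for v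
    using Suc.prems Ck_on_Suc_imp by (intro Ck_on_add[OF assms(1)] Suc.IH) auto
  have der: "f x * frechet_derivative g (at x) v + frechet_derivative f (at x) v * g x
      = frechet_derivative (\<lambda>x. f x * g x) (at x) v" if "x \<in> S" for x v
  proof -
    have "(f has_derivative frechet_derivative f (at x)) (at x)"
      "(g has_derivative frechet_derivative g (at x)) (at x)"
      using Suc.prems that by (simp_all add: frechet_derivative_works[symmetric])
    from fun_cong[OF frechet_derivative_at[OF has_derivative_mult[OF this]]] show ?thesis .
  qed
  have "Ck_on k S (\<lambda>x. frechet_derivative (\<lambda>x. f x * g x) (at x) v)" for v
    by (rule Ck_on_cong[OF assms(1) der ck])
  with Suc.prems show ?case by (simp add: differentiable_mult)
qed

lemma torus_smooth_on_subset: "torus_smooth_on V f \<Longrightarrow> U \<subseteq> V \<Longrightarrow> torus_smooth_on U f"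
  unfolding torus_smooth_on_def smooth_fun_on_def by (meson Ck_on_subset vimage_mono)

lemma torus_smooth_on_mult:
  "torus_open U \<Longrightarrow> torus_smooth_on U f \<Longrightarrow> torus_smooth_on U g \<Longrightarrow> torus_smooth_on U (\<lambda>p. f p * g p)"
  unfolding torus_smooth_on_def smooth_fun_on_def torus_open_def by (simp add: Ck_on_mult)

lemma torus_open_Int: "torus_open U \<Longrightarrow> torus_open V \<Longrightarrow> torus_open (U \<inter> V)"
  by (simp add: torus_open_def open_Int)

lemma smooth_fun_on_differentiable: "smooth_fun_on S f \<Longrightarrow> x \<in> S \<Longrightarrow> f differentiable (at x)"
  unfolding smooth_fun_on_def by (metis Ck_on.simps(2))

lemma smooth_fun_on_DERIV:
  "smooth_fun_on I f \<Longrightarrow> t \<in> I \<Longrightarrow> (f has_real_derivative deriv f t) (at t)"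
  by (simp add: DERIV_deriv_iff_real_differentiable smooth_fun_on_differentiable)

lemma torus_smooth_on_line_DERIV:
  assumes "torus_smooth_on U f" "pr (t *\<^sub>R d) \<in> U"
  shows "((\<lambda>r. f (pr (r *\<^sub>R d))) has_real_derivative torus_deriv f (t *\<^sub>R d) d) (at t)"
proof -
  let ?g = "\<lambda>z. f (pr z)"
  let ?F = "frechet_derivative ?g (at (t *\<^sub>R d))"
  have "?g differentiable (at (t *\<^sub>R d))"
    using assms smooth_fun_on_differentiable[of "pr -` U" ?g] by (simp add: torus_smooth_on_def)
  then have F: "(?g has_derivative ?F) (at (t *\<^sub>R d))"
    by (simp add: frechet_derivative_works)
  have "((\<lambda>r. r *\<^sub>R d) has_derivative (\<lambda>r. r *\<^sub>R d)) (at t)"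
    by (auto intro!: derivative_eq_intros)
  from has_derivative_compose[OF this F]
  have "((\<lambda>r. ?g (r *\<^sub>R d)) has_derivative (\<lambda>r. ?F (r *\<^sub>R d))) (at t)" .
  moreover have "?F (r *\<^sub>R d) = r * ?F d" for r
    using linear_cmul[OF has_derivative_linear[OF F]] by simp
  ultimately show ?thesis
    by (simp add: has_field_derivative_def torus_deriv_def mult.commute[of _ "?F d"])
qed

lemma open_line_preimage: "torus_open U \<Longrightarrow> open {r. pr (r *\<^sub>R d) \<in> U}"
proof -
  assume "torus_open U"
  then have "open ((\<lambda>r::real. r *\<^sub>R d) -` (pr -` U))"
    unfolding torus_open_def by (intro open_vimage continuous_intros)
  then show ?thesis by (simp add: vimage_def)
qed

section \<open>Frames and local sections\<close>

locale metric_bundle_connection =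
  fixes E :: "'e::real_vector vbundle" and h :: "torus \<Rightarrow> 'e \<Rightarrow> 'e \<Rightarrow> real" and D :: "'e conn"
  assumes vbundle: "oriented_vbundle E"
    and metric: "bundle_metric E h"
    and metric_conn: "metric_connection E h D"
begin

lemma subspace_fibre: "subspace (fibre E p)"
  using vbundle unfolding oriented_vbundle_def by (elim conjE) (rule spec)

lemma frame_at:
  obtains U e where "(U, e) \<in> frames E" "p \<in> U"
proof -
  have "\<exists>(U, e)\<in>frames E. p \<in> U"
    using vbundle unfolding oriented_vbundle_def by (elim conjE) (rule spec)
  then show ?thesis using that by blast
qed

lemma frame_props:
  assumes "(U, e) \<in> frames E"
  shows "torus_open U \<and> (\<forall>p\<in>U. inj (\<lambda>i. e i p) \<and> independent (range (\<lambda>i. e i p)) \<and>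
    span (range (\<lambda>i. e i p)) = fibre E p)"
  using vbundle assms unfolding oriented_vbundle_def by (elim conjE) (drule (1) bspec, simp)

lemma frame_open: "(U, e) \<in> frames E \<Longrightarrow> torus_open U"
  using frame_props by blast

lemma frame_basis:
  assumes "(U, e) \<in> frames E" "p \<in> U"
  shows "inj (\<lambda>i. e i p)" "span (range (\<lambda>i. e i p)) = fibre E p"
  using frame_props[OF assms(1)] assms(2) by blast+

lemma frame_transition:
  assumes "(U, e) \<in> frames E" "(V, f) \<in> frames E"
  shows "\<exists>g :: torus \<Rightarrow> real^4^4.
    (\<forall>i j. torus_smooth_on (U \<inter> V) (\<lambda>p. g p $ i $ j)) \<and>
    (\<forall>p \<in> U \<inter> V. det (g p) > 0 \<and> (\<forall>j. f j p = (\<Sum>i\<in>UNIV. g p $ i $ j *\<^sub>R e i p)))"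
proof -
  have "\<forall>(U, e) \<in> frames E. \<forall>(V, f) \<in> frames E. \<exists>g :: torus \<Rightarrow> real^4^4.
        (\<forall>i j. torus_smooth_on (U \<inter> V) (\<lambda>p. g p $ i $ j)) \<and>
        (\<forall>p \<in> U \<inter> V. det (g p) > 0 \<and> (\<forall>j. f j p = (\<Sum>i\<in>UNIV. g p $ i $ j *\<^sub>R e i p)))"
    using vbundle unfolding oriented_vbundle_def by (elim conjE)
  from bspec[OF bspec[OF this assms(1), unfolded prod.case] assms(2), unfolded prod.case]
  show ?thesis .
qed

lemma frame_in_fibre: "(U, e) \<in> frames E \<Longrightarrow> p \<in> U \<Longrightarrow> e i p \<in> fibre E p"
  using frame_basis(2) span_base by (metis rangeI)

lemma frame_coordinates:
  assumes "(U, e) \<in> frames E" "p \<in> U" "x \<in> fibre E p"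
  obtains c where "x = (\<Sum>i\<in>UNIV. c i *\<^sub>R e i p)"
proof -
  let ?e = "\<lambda>i. e i p"
  have "x \<in> span (range ?e)" using assms frame_basis(2) by blast
  then obtain u where "x = (\<Sum>a\<in>range ?e. u a *\<^sub>R a)"
    by (auto simp: span_finite)
  then have "x = (\<Sum>i\<in>UNIV. u (?e i) *\<^sub>R ?e i)"
    using frame_basis(1)[OF assms(1,2)] by (simp add: sum.reindex)
  then show ?thesis by (rule that)
qed

lemma sections_subset:
  assumes s: "s \<in> sections E U" and VU: "V \<subseteq> U"
  shows "s \<in> sections E V"
  unfolding sections_def
proof (safe)
  show "s p \<in> fibre E p" if "p \<in> V" for p
    using assms that by (auto simp: sections_def)
  fix W e assume W: "(W, e) \<in> frames E"
  have "\<forall>(W, e) \<in> frames E. \<exists>f. (\<forall>i. torus_smooth_on (U \<inter> W) (f i)) \<and>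
      (\<forall>p \<in> U \<inter> W. s p = (\<Sum>i\<in>UNIV. f i p *\<^sub>R e i p))"
    using s by (simp add: sections_def)
  from bspec[OF this W, unfolded prod.case] obtain f where "\<forall>i. torus_smooth_on (U \<inter> W) (f i)"
      "\<forall>p\<in>U \<inter> W. s p = (\<Sum>i\<in>UNIV. f i p *\<^sub>R e i p)"
    by blast
  then have "(\<forall>i. torus_smooth_on (V \<inter> W) (f i)) \<and>
      (\<forall>p\<in>V \<inter> W. s p = (\<Sum>i\<in>UNIV. f i p *\<^sub>R e i p))"
    using VU by (auto intro: torus_smooth_on_subset)
  then show "\<exists>f. (\<forall>i. torus_smooth_on (V \<inter> W) (f i)) \<and>
      (\<forall>p\<in>V \<inter> W. s p = (\<Sum>i\<in>UNIV. f i p *\<^sub>R e i p))" by blast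
qed

lemma sections_in_fibre: "s \<in> sections E U \<Longrightarrow> p \<in> U \<Longrightarrow> s p \<in> fibre E p"
  by (simp add: sections_def)

text \<open>The coefficients in any other frame are the products of \<open>f\<close> with the smooth transition functions.\<close>

lemma scaled_frame_section:
  assumes "(V, e) \<in> frames E" and U: "torus_open U" "U \<subseteq> V" and f: "torus_smooth_on U f"
  shows "(\<lambda>p. f p *\<^sub>R e j p) \<in> sections E U"
  unfolding sections_def
proof (safe)
  fix p assume "p \<in> U"
  then have "e j p \<in> fibre E p"
    using frame_in_fibre[OF assms(1)] U(2) by blast
  then show "f p *\<^sub>R e j p \<in> fibre E p"
    by (rule subspace_scale[OF subspace_fibre])
next
  fix W e' assume W: "(W, e') \<in> frames E"
  obtain g :: "torus \<Rightarrow> real^4^4" where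
    g: "\<forall>i j. torus_smooth_on (W \<inter> V) (\<lambda>p. g p $ i $ j)"
      "\<forall>p \<in> W \<inter> V. det (g p) > 0 \<and> (\<forall>j. e j p = (\<Sum>i\<in>UNIV. g p $ i $ j *\<^sub>R e' i p))"
    using frame_transition[OF W assms(1)] by blast
  have UW: "torus_open (U \<inter> W)" by (intro torus_open_Int U(1) frame_open[OF W])
  have "torus_smooth_on (U \<inter> W) (\<lambda>p. f p * g p $ i $ j)" for i
    by (rule torus_smooth_on_mult[OF UW torus_smooth_on_subset[OF f] torus_smooth_on_subset[OF g(1)[rule_format]]])
      (use U(2) in auto)
  moreover have "f p *\<^sub>R e j p = (\<Sum>i\<in>UNIV. (f p * g p $ i $ j) *\<^sub>R e' i p)" if "p \<in> U \<inter> W" for p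
  proof -
    have "p \<in> W \<inter> V" using that U(2) by blast
    then have "e j p = (\<Sum>i\<in>UNIV. g p $ i $ j *\<^sub>R e' i p)" using g(2) by blast
    then show ?thesis by (simp add: scaleR_sum_right)
  qed
  ultimately have "(\<forall>i. torus_smooth_on (U \<inter> W) (\<lambda>p. f p * g p $ i $ j)) \<and>
      (\<forall>p\<in>U \<inter> W. f p *\<^sub>R e j p = (\<Sum>i\<in>UNIV. (f p * g p $ i $ j) *\<^sub>R e' i p))" by blast
  then show "\<exists>fa. (\<forall>i. torus_smooth_on (U \<inter> W) (fa i)) \<and>
      (\<forall>p\<in>U \<inter> W. f p *\<^sub>R e j p = (\<Sum>i\<in>UNIV. fa i p *\<^sub>R e' i p))"
    by (intro exI[of _ "\<lambda>i p. f p * g p $ i $ j"])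
qed

text \<open>Locally \<open>\<omega>\<close> is the sum of the products \<open>(f i j *\<^sub>R e i) \<wedge> e j\<close> of smooth sections. Hence the
description of the induced connection applies to every section near every point.\<close>

lemma ext2_section_local_wedges:
  assumes "\<omega> \<in> ext2_sections E U" "torus_open U" "p \<in> U"
  shows "\<exists>V (n::nat) s t. torus_open V \<and> p \<in> V \<and>
    (\<forall>k<n. s k \<in> sections E V \<and> t k \<in> sections E V) \<and>
    (\<forall>q\<in>V. \<omega> q = (\<Sum>k<n. wedge (s k q) (t k q)))"
proof -
  obtain W e where W: "(W, e) \<in> frames E" "p \<in> W" by (rule frame_at)
  have "\<forall>(W, e) \<in> frames E. \<exists>f. (\<forall>i j. torus_smooth_on (U \<inter> W) (f i j)) \<and>
      (\<forall>q \<in> U \<inter> W. \<omega> q = (\<Sum>i\<in>UNIV. \<Sum>j\<in>UNIV. f i j q *\<^sub>R wedge (e i q) (e j q)))"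
    using assms(1) by (simp add: ext2_sections_def)
  from bspec[OF this W(1), unfolded prod.case]
  obtain f where f: "\<And>i j. torus_smooth_on (U \<inter> W) (f i j)"
    and \<omega>: "\<And>q. q \<in> U \<inter> W \<Longrightarrow> \<omega> q = (\<Sum>i\<in>UNIV. \<Sum>j\<in>UNIV. f i j q *\<^sub>R wedge (e i q) (e j q))"
    by blast
  obtain b :: "nat \<Rightarrow> 4 \<times> 4" where b: "bij_betw b {..<CARD(4 \<times> 4)} UNIV"
    using ex_bij_betw_nat_finite[of "UNIV :: (4 \<times> 4) set"] by (auto simp: atLeast0LessThan)
  let ?s = "\<lambda>k q. f (fst (b k)) (snd (b k)) q *\<^sub>R e (fst (b k)) q"
  let ?t = "\<lambda>k q. e (snd (b k)) q"
  have open_V: "torus_open (U \<inter> W)" using assms W frame_open torus_open_Int by blast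
  have one: "torus_smooth_on (U \<inter> W) (\<lambda>_. 1)"
    by (simp add: torus_smooth_on_def smooth_fun_on_def Ck_on_const)
  have s: "?s k \<in> sections E (U \<inter> W)" if "k < CARD(4 \<times> 4)" for k
    by (rule scaled_frame_section[OF W(1) open_V _ f]) simp
  have t: "?t k \<in> sections E (U \<inter> W)" if "k < CARD(4 \<times> 4)" for k
    using scaled_frame_section[OF W(1) open_V _ one] by simp
  have sum: "\<omega> q = (\<Sum>k<CARD(4 \<times> 4). wedge (?s k q) (?t k q))" if q: "q \<in> U \<inter> W" for q
  proof -
    have "\<omega> q = (\<Sum>(i, j)\<in>UNIV. wedge (f i j q *\<^sub>R e i q) (e j q))"
      unfolding \<omega>[OF q] by (simp add: sum.cartesian_product bilinear_lmul[OF bilinear_wedge])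
    also have "\<dots> = (\<Sum>k<CARD(4 \<times> 4). wedge (?s k q) (?t k q))"
      by (subst sum.reindex_bij_betw[OF b, symmetric]) (simp add: case_prod_unfold)
    finally show ?thesis .
  qed
  have "p \<in> U \<inter> W" using assms(3) W(2) by blast
  with open_V s t sum have "torus_open (U \<inter> W) \<and> p \<in> U \<inter> W \<and>
      (\<forall>k<CARD(4 \<times> 4). ?s k \<in> sections E (U \<inter> W) \<and> ?t k \<in> sections E (U \<inter> W)) \<and>
      (\<forall>q\<in>U \<inter> W. \<omega> q = (\<Sum>k<CARD(4 \<times> 4). wedge (?s k q) (?t k q)))"
    by blast
  then show ?thesis by (intro exI)
qed

section \<open>The metric along parallel sections\<close>

text \<open>The metric is bilinear on the fibres only, whereas functionals on the exterior square arise from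
forms on the whole ambient space. Composing with a projection onto the fibre extends the
metric to a bilinear form \<open>metric_ext\<close>.\<close>

definition fibre_proj :: "torus \<Rightarrow> 'e \<Rightarrow> 'e" where
  "fibre_proj p = (SOME f. linear f \<and> (\<forall>x. f x \<in> fibre E p) \<and> (\<forall>x\<in>fibre E p. f x = x))"

lemma fibre_proj:
  shows linear_fibre_proj: "linear (fibre_proj p)"
    and fibre_proj_in: "fibre_proj p x \<in> fibre E p"
    and fibre_proj_id: "x \<in> fibre E p \<Longrightarrow> fibre_proj p x = x"
proof -
  have "\<exists>f. range f \<subseteq> fibre E p \<and> linear f \<and> (\<forall>x\<in>fibre E p. f (id x) = x)"
    using linear_exists_left_inverse_on[OF linear_id subspace_fibre[of p]] by simp
  then have "\<exists>f. linear f \<and> (\<forall>x. f x \<in> fibre E p) \<and> (\<forall>x\<in>fibre E p. f x = x)"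
    by auto
  from someI_ex[OF this] show "linear (fibre_proj p)" "fibre_proj p x \<in> fibre E p"
    "x \<in> fibre E p \<Longrightarrow> fibre_proj p x = x"
    unfolding fibre_proj_def[symmetric] by blast+
qed

definition metric_ext :: "torus \<Rightarrow> 'e \<Rightarrow> 'e \<Rightarrow> real" where
  "metric_ext p x y = h p (fibre_proj p x) (fibre_proj p y)"

lemma metric_ext_eq: "x \<in> fibre E p \<Longrightarrow> y \<in> fibre E p \<Longrightarrow> metric_ext p x y = h p x y"
  by (simp add: metric_ext_def fibre_proj_id)

lemma metric_fibre:
  assumes "u \<in> fibre E p" "v \<in> fibre E p" "w \<in> fibre E p"
  shows "h p (u + v) w = h p u w + h p v w" "h p (c *\<^sub>R u) w = c * h p u w" "h p u v = h p v u"
  using metric assms unfolding bundle_metric_def by blast+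

lemma metric_ext_commute: "metric_ext p x y = metric_ext p y x"
  unfolding metric_ext_def by (rule metric_fibre(3)) (rule fibre_proj_in)+

lemma linear_metric_ext_left: "linear (\<lambda>x. metric_ext p x y)"
  by (rule linearI)
    (simp_all add: metric_ext_def linear_add[OF linear_fibre_proj] linear_cmul[OF linear_fibre_proj]
      metric_fibre(1,2)[OF fibre_proj_in fibre_proj_in fibre_proj_in])

lemma linear_metric_ext_right: "linear (metric_ext p x)"
proof -
  have "metric_ext p x = (\<lambda>y. metric_ext p y x)" by (rule ext) (rule metric_ext_commute)
  then show ?thesis by (simp only: linear_metric_ext_left)
qed

lemmas metric_ext_simps =
  linear_0[OF linear_metric_ext_left] linear_add[OF linear_metric_ext_left]
  linear_cmul[OF linear_metric_ext_left] linear_sum[OF linear_metric_ext_left]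
  linear_0[OF linear_metric_ext_right] linear_add[OF linear_metric_ext_right]
  linear_cmul[OF linear_metric_ext_right] linear_sum[OF linear_metric_ext_right]

lemma conn_section: "torus_open U \<Longrightarrow> s \<in> sections E U \<Longrightarrow> D v s \<in> sections E U"
  using metric_conn unfolding metric_connection_def connection_def by blast

lemma metric_sections_DERIV:
  assumes U: "torus_open U" and s: "s \<in> sections E U" and s': "s' \<in> sections E U"
    and t: "pr (t *\<^sub>R d) \<in> U"
  shows "((\<lambda>r. metric_ext (pr (r *\<^sub>R d)) (s (pr (r *\<^sub>R d))) (s' (pr (r *\<^sub>R d)))) has_real_derivative
    metric_ext (pr (t *\<^sub>R d)) (D d s (pr (t *\<^sub>R d))) (s' (pr (t *\<^sub>R d)))
    + metric_ext (pr (t *\<^sub>R d)) (s (pr (t *\<^sub>R d))) (D d s' (pr (t *\<^sub>R d)))) (at t)"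
proof -
  let ?f = "\<lambda>q. h q (s q) (s' q)"
  have "torus_smooth_on U ?f"
    using metric U s s' unfolding bundle_metric_def by blast
  from torus_smooth_on_line_DERIV[OF this t]
  have "((\<lambda>r. ?f (pr (r *\<^sub>R d))) has_real_derivative torus_deriv ?f (t *\<^sub>R d) d) (at t)" .
  moreover have "torus_deriv ?f (t *\<^sub>R d) d =
      h (pr (t *\<^sub>R d)) (D d s (pr (t *\<^sub>R d))) (s' (pr (t *\<^sub>R d)))
    + h (pr (t *\<^sub>R d)) (s (pr (t *\<^sub>R d))) (D d s' (pr (t *\<^sub>R d)))"
    using metric_conn U s s' t unfolding metric_connection_def by blast
  moreover have "s q \<in> fibre E q" "s' q \<in> fibre E q" "D v s q \<in> fibre E q" "D v s' q \<in> fibre E q"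
    if "q \<in> U" for q v
    using that conn_section[OF U s] conn_section[OF U s'] s s' sections_in_fibre by blast+
  ultimately have "((\<lambda>r. ?f (pr (r *\<^sub>R d))) has_real_derivative
      metric_ext (pr (t *\<^sub>R d)) (D d s (pr (t *\<^sub>R d))) (s' (pr (t *\<^sub>R d)))
    + metric_ext (pr (t *\<^sub>R d)) (s (pr (t *\<^sub>R d))) (D d s' (pr (t *\<^sub>R d)))) (at t)"
    using t by (simp add: metric_ext_eq)
  then show ?thesis
    by (rule has_field_derivative_transform_within_open[OF _ open_line_preimage[OF U]])
      (use t s s' in \<open>auto simp: metric_ext_eq sections_in_fibre\<close>)
qed

text \<open>Near \<open>t\<close> both \<open>u\<close> and \<open>u'\<close> are combinations of pulled back sections, so the claim follows from the
metric property of the connection on sections, the chain rule and the product rule for the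
coefficient functions.\<close>

lemma covariant_product_rule:
  assumes u: "has_covariant_derivative (sections E) D d u w t"
    and u': "has_covariant_derivative (sections E) D d u' w' t"
  shows "((\<lambda>r. metric_ext (pr (r *\<^sub>R d)) (u r) (u' r)) has_real_derivative
    metric_ext (pr (t *\<^sub>R d)) w (u' t) + metric_ext (pr (t *\<^sub>R d)) (u t) w') (at t)"
proof -
  let ?p = "\<lambda>r. pr (r *\<^sub>R d)"
  from u obtain I U and n :: nat and f s where I: "open I" "t \<in> I" and U: "torus_open U" "\<forall>r\<in>I. ?p r \<in> U"
    and fs: "\<forall>k<n. smooth_fun_on I (f k) \<and> s k \<in> sections E U"
    and u_eq: "\<forall>r\<in>I. u r = (\<Sum>k<n. f k r *\<^sub>R s k (?p r))"
    and w: "w = (\<Sum>k<n. deriv (f k) t *\<^sub>R s k (?p t) + f k t *\<^sub>R D d (s k) (?p t))"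
    unfolding has_covariant_derivative_def by blast
  from u' obtain I' U' and n' :: nat and f' s' where I': "open I'" "t \<in> I'"
    and U': "torus_open U'" "\<forall>r\<in>I'. ?p r \<in> U'"
    and fs': "\<forall>k<n'. smooth_fun_on I' (f' k) \<and> s' k \<in> sections E U'"
    and u'_eq: "\<forall>r\<in>I'. u' r = (\<Sum>k<n'. f' k r *\<^sub>R s' k (?p r))"
    and w': "w' = (\<Sum>k<n'. deriv (f' k) t *\<^sub>R s' k (?p t) + f' k t *\<^sub>R D d (s' k) (?p t))"
    unfolding has_covariant_derivative_def by blast
  define g where "g k l r = metric_ext (?p r) (s k (?p r)) (s' l (?p r))" for k l r
  define g' where "g' k l = metric_ext (?p t) (D d (s k) (?p t)) (s' l (?p t))
      + metric_ext (?p t) (s k (?p t)) (D d (s' l) (?p t))" for k l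
  have g: "(g k l has_real_derivative g' k l) (at t)" if "k < n" "l < n'" for k l
    unfolding g_def g'_def
    by (rule metric_sections_DERIV[OF torus_open_Int[OF U(1) U'(1)]])
      (use that fs fs' U U' I I' in \<open>auto intro: sections_subset\<close>)
  have f: "(f k has_real_derivative deriv (f k) t) (at t)" if "k < n" for k
    using fs that I smooth_fun_on_DERIV by blast
  have f': "(f' l has_real_derivative deriv (f' l) t) (at t)" if "l < n'" for l
    using fs' that I' smooth_fun_on_DERIV by blast
  have "((\<lambda>r. \<Sum>k<n. \<Sum>l<n'. f k r * f' l r * g k l r) has_real_derivative
      (\<Sum>k<n. \<Sum>l<n'. (deriv (f k) t * f' l t + f k t * deriv (f' l) t) * g k l t
         + f k t * f' l t * g' k l)) (at t)"
    by (intro DERIV_sum) (auto intro!: derivative_eq_intros f f' g simp: algebra_simps)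
  moreover have eq: "metric_ext (?p r) (u r) (u' r) = (\<Sum>k<n. \<Sum>l<n'. f k r * f' l r * g k l r)"
    if "r \<in> I \<inter> I'" for r
  proof -
    have "metric_ext (?p r) (u r) (u' r) = (\<Sum>l<n'. \<Sum>k<n. f k r * f' l r * g k l r)"
      using that u_eq u'_eq by (simp add: metric_ext_simps g_def sum_distrib_left algebra_simps)
    also have "\<dots> = (\<Sum>k<n. \<Sum>l<n'. f k r * f' l r * g k l r)" by (rule sum.swap)
    finally show ?thesis .
  qed
  moreover have "metric_ext (?p t) w (u' t) + metric_ext (?p t) (u t) w' =
      (\<Sum>k<n. \<Sum>l<n'. (deriv (f k) t * f' l t + f k t * deriv (f' l) t) * g k l t
         + f k t * f' l t * g' k l)"
  proof -
    have "metric_ext (?p t) w (u' t) = (\<Sum>l<n'. \<Sum>k<n. f' l t * deriv (f k) t * g k l t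
        + f' l t * f k t * metric_ext (?p t) (D d (s k) (?p t)) (s' l (?p t)))"
      using u'_eq I' by (simp add: w metric_ext_simps g_def sum_distrib_left algebra_simps)
    also have "\<dots> = (\<Sum>k<n. \<Sum>l<n'. f' l t * deriv (f k) t * g k l t
        + f' l t * f k t * metric_ext (?p t) (D d (s k) (?p t)) (s' l (?p t)))"
      by (rule sum.swap)
    finally have 1: "metric_ext (?p t) w (u' t) = \<dots>" .
    have "metric_ext (?p t) (u t) w' = (\<Sum>l<n'. \<Sum>k<n. f k t * deriv (f' l) t * g k l t
        + f' l t * f k t * metric_ext (?p t) (s k (?p t)) (D d (s' l) (?p t)))"
      using u_eq I by (simp add: w' metric_ext_simps g_def sum_distrib_left sum.distrib algebra_simps)
    also have "\<dots> = (\<Sum>k<n. \<Sum>l<n'. f k t * deriv (f' l) t * g k l t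
        + f' l t * f k t * metric_ext (?p t) (s k (?p t)) (D d (s' l) (?p t)))"
      by (rule sum.swap)
    finally have 2: "metric_ext (?p t) (u t) w' = \<dots>" .
    show ?thesis
      unfolding 1 2 sum.distrib[symmetric] by (simp add: g'_def algebra_simps)
  qed
  ultimately have "((\<lambda>r. \<Sum>k<n. \<Sum>l<n'. f k r * f' l r * g k l r) has_real_derivative
      metric_ext (?p t) w (u' t) + metric_ext (?p t) (u t) w') (at t)"
    by simp
  then show ?thesis
    by (rule has_field_derivative_transform_within_open[OF _ open_Int[OF I(1) I'(1)]])
      (use I(2) I'(2) eq in auto)
qed

lemma section_covariant_derivative:
  assumes "torus_open U" "s \<in> sections E U" "pr (t *\<^sub>R d) \<in> U"
  shows "has_covariant_derivative (sections E) D d (\<lambda>r. s (pr (r *\<^sub>R d))) (D d s (pr (t *\<^sub>R d))) t"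
  unfolding has_covariant_derivative_def
proof (intro exI conjI)
  let ?I = "{r. pr (r *\<^sub>R d) \<in> U}"
  show "open ?I" by (rule open_line_preimage[OF assms(1)])
  show "\<forall>k<1::nat. smooth_fun_on ?I (\<lambda>_. 1) \<and> s \<in> sections E U"
    using assms(2) by (simp add: smooth_fun_on_def Ck_on_const)
  show "\<forall>r\<in>?I. s (pr (r *\<^sub>R d)) = (\<Sum>k<1::nat. 1 *\<^sub>R s (pr (r *\<^sub>R d)))" by simp
  show "D d s (pr (t *\<^sub>R d)) = (\<Sum>k<1::nat. deriv (\<lambda>_. 1) t *\<^sub>R s (pr (t *\<^sub>R d)) + 1 *\<^sub>R D d s (pr (t *\<^sub>R d)))"
    by simp
qed (use assms in auto)

lemma parallel_in_fibre: "parallel_along (sections E) D d u \<Longrightarrow> u t \<in> fibre E (pr (t *\<^sub>R d))"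
proof -
  assume "parallel_along (sections E) D d u"
  then have "has_covariant_derivative (sections E) D d u 0 t"
    by (simp add: parallel_along_def)
  then obtain I U and n :: nat and f s where "t \<in> I" "\<forall>r\<in>I. pr (r *\<^sub>R d) \<in> U"
    "\<forall>k<n. smooth_fun_on I (f k) \<and> s k \<in> sections E U"
    "\<forall>r\<in>I. u r = (\<Sum>k<n. f k r *\<^sub>R s k (pr (r *\<^sub>R d)))"
    unfolding has_covariant_derivative_def by blast
  then show ?thesis
    by (auto intro!: subspace_sum[OF subspace_fibre] subspace_scale[OF subspace_fibre] sections_in_fibre)
qed

lemma parallel_metric_const:
  assumes u: "parallel_along (sections E) D d u" and u': "parallel_along (sections E) D d u'"
  shows "metric_ext (pr (r *\<^sub>R d)) (u r) (u' r) = metric_ext (pr (0, 0)) (u 0) (u' 0)"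
proof -
  have "((\<lambda>r. metric_ext (pr (r *\<^sub>R d)) (u r) (u' r)) has_real_derivative 0) (at t)" for t
    using covariant_product_rule[of d u 0 t u' 0] u u' by (simp add: parallel_along_def metric_ext_simps)
  from DERIV_isconst_all[of "\<lambda>r. metric_ext (pr (r *\<^sub>R d)) (u r) (u' r)" r 0] this
  have "metric_ext (pr (r *\<^sub>R d)) (u r) (u' r) = metric_ext (pr (0 *\<^sub>R d)) (u 0) (u' 0)" by blast
  then show ?thesis by (simp add: zero_prod_def)
qed

text \<open>Let \<open>X\<close> express \<open>w\<close> in a local frame \<open>e\<close> and let \<open>Y\<close> be the matrix of the inner products of \<open>w\<close> with \<open>e\<close>.
Orthonormality of \<open>w\<close> means \<open>Y X = 1\<close>, hence \<open>X Y = 1\<close>, so that \<open>w\<close> spans the fibre.\<close>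

lemma orthonormal_expansion:
  fixes w :: "4 \<Rightarrow> 'e"
  assumes w: "\<And>i. w i \<in> fibre E p" and on: "\<And>i j. metric_ext p (w i) (w j) = (if i = j then 1 else 0)"
    and x: "x \<in> fibre E p"
  shows "x = (\<Sum>a\<in>UNIV. metric_ext p x (w a) *\<^sub>R w a)"
proof -
  obtain U e where Ue: "(U, e) \<in> frames E" "p \<in> U" by (rule frame_at)
  have coord: "\<exists>c. y = (\<Sum>i\<in>UNIV. c i *\<^sub>R e i p)" if "y \<in> fibre E p" for y
    using frame_coordinates[OF Ue that] by metis
  from coord w have "\<forall>j. \<exists>c. w j = (\<Sum>i\<in>UNIV. c i *\<^sub>R e i p)" by blast
  then obtain c where c: "\<And>j. w j = (\<Sum>i\<in>UNIV. c j i *\<^sub>R e i p)" by metis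
  define X :: "real^4^4" where "X = (\<chi> i j. c j i)"
  define Y :: "real^4^4" where "Y = (\<chi> a k. metric_ext p (e k p) (w a))"
  have wX: "w j = (\<Sum>i\<in>UNIV. X $ i $ j *\<^sub>R e i p)" for j
    unfolding c by (simp add: X_def)
  have "(Y ** X) $ a $ b = mat 1 $ a $ b" for a b
  proof -
    have "(Y ** X) $ a $ b = metric_ext p (\<Sum>i\<in>UNIV. X $ i $ b *\<^sub>R e i p) (w a)"
      by (simp add: Y_def matrix_matrix_mult_def metric_ext_simps mult.commute)
    then have "(Y ** X) $ a $ b = metric_ext p (w b) (w a)" unfolding wX[symmetric] .
    then show ?thesis by (simp add: on mat_def)
  qed
  then have "Y ** X = mat 1" by (simp add: vec_eq_iff)
  then have XY: "X ** Y = mat 1" by (rule matrix_left_right_inverse[THEN iffD1])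
  have e: "e k p = (\<Sum>a\<in>UNIV. Y $ a $ k *\<^sub>R w a)" for k
    unfolding wX matrix_comb_comb XY by (simp add: mat_def if_distrib[of "\<lambda>x. x *\<^sub>R _"] cong: if_cong)
  obtain d where "x = (\<Sum>k\<in>UNIV. d k *\<^sub>R e k p)" using coord[OF x] by blast
  also have "\<dots> = (\<Sum>k\<in>UNIV. \<Sum>a\<in>UNIV. (d k * Y $ a $ k) *\<^sub>R w a)"
    unfolding e by (simp add: scaleR_sum_right)
  also have "\<dots> = (\<Sum>a\<in>UNIV. (\<Sum>k\<in>UNIV. d k * Y $ a $ k) *\<^sub>R w a)"
    by (subst sum.swap) (simp add: scaleR_sum_left)
  finally have x_eq: "x = (\<Sum>a\<in>UNIV. (\<Sum>k\<in>UNIV. d k * Y $ a $ k) *\<^sub>R w a)" .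
  have "metric_ext p x (w b) = (\<Sum>k\<in>UNIV. d k * Y $ b $ k)" for b
    by (subst x_eq) (simp add: metric_ext_simps on if_distrib[of "(*) _"] cong: if_cong)
  with x_eq show ?thesis by simp
qed

section \<open>The induced connection on the exterior square\<close>

definition pairing :: "torus \<Rightarrow> 'e \<Rightarrow> 'e \<Rightarrow> 'e ext2 \<Rightarrow> real" where
  "pairing p u v = ext2_eval (coform (\<lambda>x. metric_ext p x u) (\<lambda>x. metric_ext p x v))"

lemma linear_pairing: "linear (pairing p u v)"
  by (simp add: pairing_def linear_ext2_eval)

lemmas pairing_simps = linear_0[OF linear_pairing] linear_add[OF linear_pairing]
  linear_diff[OF linear_pairing] linear_cmul[OF linear_pairing] linear_sum[OF linear_pairing]

lemma pairing_wedge: "pairing p u v (wedge x y) = metric_ext p x u * metric_ext p y v - metric_ext p y u * metric_ext p x v"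
  unfolding pairing_def ext2_eval_wedge[OF alternating_coform[OF linear_metric_ext_left linear_metric_ext_left]]
  by (simp add: coform_def)

lemma wedge_in_ext2_fibre: "x \<in> fibre E p \<Longrightarrow> y \<in> fibre E p \<Longrightarrow> wedge x y \<in> ext2_fibre E p"
  unfolding ext2_fibre_def by (rule span_base) blast

lemma subspace_ext2_fibre: "subspace (ext2_fibre E p)"
  by (simp add: ext2_fibre_def)

text \<open>On the fibre, summing the pairings with \<open>w a \<wedge> w b\<close> times these bivectors over all ordered pairs
gives twice the bivector.\<close>

lemma pairing_separates:
  fixes w :: "4 \<Rightarrow> 'e"
  assumes w: "\<And>i. w i \<in> fibre E p" and on: "\<And>i j. metric_ext p (w i) (w j) = (if i = j then 1 else 0)"
    and z: "z \<in> ext2_fibre E p" "z' \<in> ext2_fibre E p"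
    and eq: "\<And>a b. pairing p (w a) (w b) z = pairing p (w a) (w b) z'"
  shows "z = z'"
proof -
  let ?R = "\<lambda>z. \<Sum>a\<in>UNIV. \<Sum>b\<in>UNIV. pairing p (w a) (w b) z *\<^sub>R wedge (w a) (w b)"
  have lin: "linear ?R"
    by (rule linearI) (simp_all add: pairing_simps scaleR_add_left sum.distrib scaleR_sum_right)
  have lin2: "linear (\<lambda>z::'e ext2. 2 *\<^sub>R z)"
    by (rule linearI) (simp_all add: scaleR_add_right)
  have R: "?R z = 2 *\<^sub>R z" if "z \<in> ext2_fibre E p" for z
  proof (rule linear_eq_on_span[OF lin lin2])
    show "z \<in> span {wedge x y |x y. x \<in> fibre E p \<and> y \<in> fibre E p}"
      using that by (simp add: ext2_fibre_def)
    fix b assume "b \<in> {wedge x y |x y. x \<in> fibre E p \<and> y \<in> fibre E p}"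
    then obtain x y where b: "b = wedge x y" and x: "x \<in> fibre E p" and y: "y \<in> fibre E p" by blast
    have expand: "wedge x y = (\<Sum>a\<in>UNIV. \<Sum>b\<in>UNIV. (metric_ext p x (w a) * metric_ext p y (w b)) *\<^sub>R wedge (w a) (w b))"
      if x: "x \<in> fibre E p" and y: "y \<in> fibre E p" for x y
    proof -
      have "wedge x y = wedge (\<Sum>a\<in>UNIV. metric_ext p x (w a) *\<^sub>R w a) (\<Sum>b\<in>UNIV. metric_ext p y (w b) *\<^sub>R w b)"
        using orthonormal_expansion[OF w on x] orthonormal_expansion[OF w on y] by simp
      then show ?thesis
        by (simp add: bilinear_sum[OF bilinear_wedge] bilinear_lmul[OF bilinear_wedge]
          bilinear_rmul[OF bilinear_wedge] sum.cartesian_product mult.commute)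
    qed
    have "wedge y x = - wedge x y"
      by (rule ext2_eqI) (simp add: linear_neg[OF linear_ext2_eval] alternating_formD(4)[of _ x y])
    then have "2 *\<^sub>R wedge x y = wedge x y - wedge y x" by (simp add: scaleR_2)
    also have "\<dots> = ?R (wedge x y)"
      unfolding expand[OF x y] expand[OF y x] sum_subtractf[symmetric] scaleR_diff_left[symmetric]
      unfolding expand[OF x y, symmetric] by (simp add: pairing_wedge mult.commute)
    finally show "?R b = 2 *\<^sub>R b" unfolding b by simp
  qed
  have "2 *\<^sub>R z = 2 *\<^sub>R z'"
    unfolding R[OF z(1), symmetric] R[OF z(2), symmetric] eq ..
  then show ?thesis by simp
qed

text \<open>Orthonormality is demanded at 0 only; it propagates along the line because the metric
is constant on parallel sections.\<close>

definition parallel_frame :: "real \<times> real \<Rightarrow> (4 \<Rightarrow> real \<Rightarrow> 'e) \<Rightarrow> bool" where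
  "parallel_frame d \<xi> \<longleftrightarrow> (\<forall>i. parallel_along (sections E) D d (\<xi> i)) \<and>
     (\<forall>i j. metric_ext (pr (0, 0)) (\<xi> i 0) (\<xi> j 0) = (if i = j then 1 else 0))"

lemma parallel_frame_onb:
  assumes "parallel_frame d \<xi>"
  shows "\<xi> i r \<in> fibre E (pr (r *\<^sub>R d))"
    and "metric_ext (pr (r *\<^sub>R d)) (\<xi> i r) (\<xi> j r) = (if i = j then 1 else 0)"
  using assms parallel_in_fibre parallel_metric_const by (simp_all add: parallel_frame_def)

text \<open>The Leibniz rule for the induced connection, tested against parallel sections.\<close>

lemma wedge_pairing_DERIV:
  assumes V: "torus_open V" "pr (t *\<^sub>R d) \<in> V"
    and s: "\<forall>k<(n::nat). s k \<in> sections E V \<and> s' k \<in> sections E V"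
    and u: "parallel_along (sections E) D d u" and v: "parallel_along (sections E) D d v"
  shows "((\<lambda>r. pairing (pr (r *\<^sub>R d)) (u r) (v r) (\<Sum>k<n. wedge (s k (pr (r *\<^sub>R d))) (s' k (pr (r *\<^sub>R d)))))
    has_real_derivative
      pairing (pr (t *\<^sub>R d)) (u t) (v t) (\<Sum>k<n. wedge (D d (s k) (pr (t *\<^sub>R d))) (s' k (pr (t *\<^sub>R d)))
        + wedge (s k (pr (t *\<^sub>R d))) (D d (s' k) (pr (t *\<^sub>R d))))) (at t)"
proof -
  have *: "((\<lambda>r. metric_ext (pr (r *\<^sub>R d)) (s (pr (r *\<^sub>R d))) (u r)) has_real_derivative
      metric_ext (pr (t *\<^sub>R d)) (D d s (pr (t *\<^sub>R d))) (u t)) (at t)"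
    if "s \<in> sections E V" "parallel_along (sections E) D d u" for s u
    using covariant_product_rule[OF section_covariant_derivative[OF V(1) that(1) V(2)], of u 0] that(2)
    by (simp add: parallel_along_def metric_ext_simps)
  show ?thesis
    unfolding pairing_simps pairing_wedge
  proof (rule DERIV_sum)
    fix k assume "k \<in> {..<n}"
    with s have sk: "s k \<in> sections E V" "s' k \<in> sections E V" by auto
    show "((\<lambda>r. metric_ext (pr (r *\<^sub>R d)) (s k (pr (r *\<^sub>R d))) (u r) * metric_ext (pr (r *\<^sub>R d)) (s' k (pr (r *\<^sub>R d))) (v r)
        - metric_ext (pr (r *\<^sub>R d)) (s' k (pr (r *\<^sub>R d))) (u r) * metric_ext (pr (r *\<^sub>R d)) (s k (pr (r *\<^sub>R d))) (v r))
      has_real_derivative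
        metric_ext (pr (t *\<^sub>R d)) (D d (s k) (pr (t *\<^sub>R d))) (u t) * metric_ext (pr (t *\<^sub>R d)) (s' k (pr (t *\<^sub>R d))) (v t)
        - metric_ext (pr (t *\<^sub>R d)) (s' k (pr (t *\<^sub>R d))) (u t) * metric_ext (pr (t *\<^sub>R d)) (D d (s k) (pr (t *\<^sub>R d))) (v t)
        + (metric_ext (pr (t *\<^sub>R d)) (s k (pr (t *\<^sub>R d))) (u t) * metric_ext (pr (t *\<^sub>R d)) (D d (s' k) (pr (t *\<^sub>R d))) (v t)
        - metric_ext (pr (t *\<^sub>R d)) (D d (s' k) (pr (t *\<^sub>R d))) (u t) * metric_ext (pr (t *\<^sub>R d)) (s k (pr (t *\<^sub>R d))) (v t)))
      (at t)"
      by (rule DERIV_cong, rule DERIV_diff;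
          (rule DERIV_mult[OF *[OF sk(1) u] *[OF sk(2) v]] DERIV_mult[OF *[OF sk(2) u] *[OF sk(1) v]])?)
        (simp add: algebra_simps)
  qed
qed

text \<open>All values \<open>\<eta>\<close> which the Leibniz rule yields for some decomposition of \<open>\<omega>\<close> into products have the same
pairings with the bivectors of the parallel frame, namely the derivatives of those of \<open>\<omega>\<close>.
Therefore \<open>\<eta>\<close> is unique, the definite description in the definition of the induced connection
denotes it, and it inherits this property.\<close>

lemma ext2_connection_DERIV:
  assumes U: "torus_open U" "pr (t *\<^sub>R d) \<in> U" and \<omega>: "\<omega> \<in> ext2_sections E U"
    and \<xi>: "parallel_frame d \<xi>"
  shows "((\<lambda>r. pairing (pr (r *\<^sub>R d)) (\<xi> a r) (\<xi> b r) (\<omega> (pr (r *\<^sub>R d)))) has_real_derivative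
      pairing (pr (t *\<^sub>R d)) (\<xi> a t) (\<xi> b t) (ext2_connection E D d \<omega> (pr (t *\<^sub>R d)))) (at t)"
proof -
  let ?p = "pr (t *\<^sub>R d)"
  define R where "R \<eta> \<longleftrightarrow> (\<exists>U (n::nat) s s'. torus_open U \<and> ?p \<in> U \<and>
     (\<forall>k<n. s k \<in> sections E U \<and> s' k \<in> sections E U) \<and>
     (\<forall>q\<in>U. \<omega> q = (\<Sum>k<n. wedge (s k q) (s' k q))) \<and>
     \<eta> = (\<Sum>k<n. wedge (D d (s k) ?p) (s' k ?p) + wedge (s k ?p) (D d (s' k) ?p)))" for \<eta>
  have ex: "\<exists>\<eta>. R \<eta>"
  proof -
    obtain V and n :: nat and s s' where "torus_open V" "?p \<in> V"
      "\<forall>k<n. s k \<in> sections E V \<and> s' k \<in> sections E V"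
      "\<forall>q\<in>V. \<omega> q = (\<Sum>k<n. wedge (s k q) (s' k q))"
      using ext2_section_local_wedges[OF \<omega> U] by blast
    then have "R (\<Sum>k<n. wedge (D d (s k) ?p) (s' k ?p) + wedge (s k ?p) (D d (s' k) ?p))"
      unfolding R_def by blast
    then show ?thesis ..
  qed
  have R: "\<eta> \<in> ext2_fibre E ?p \<and> (\<forall>a b.
     ((\<lambda>r. pairing (pr (r *\<^sub>R d)) (\<xi> a r) (\<xi> b r) (\<omega> (pr (r *\<^sub>R d)))) has_real_derivative
      pairing ?p (\<xi> a t) (\<xi> b t) \<eta>) (at t))" if "R \<eta>" for \<eta>
  proof -
    from that obtain V and n :: nat and s s' where V: "torus_open V" "?p \<in> V"
      and s: "\<forall>k<n. s k \<in> sections E V \<and> s' k \<in> sections E V"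
      and \<omega>_eq: "\<forall>q\<in>V. \<omega> q = (\<Sum>k<n. wedge (s k q) (s' k q))"
      and \<eta>: "\<eta> = (\<Sum>k<n. wedge (D d (s k) ?p) (s' k ?p) + wedge (s k ?p) (D d (s' k) ?p))"
      unfolding R_def by blast
    have "s k ?p \<in> fibre E ?p" "s' k ?p \<in> fibre E ?p" "D d (s k) ?p \<in> fibre E ?p"
      "D d (s' k) ?p \<in> fibre E ?p" if "k < n" for k
      using s that V conn_section[OF V(1)] sections_in_fibre by blast+
    then have "\<eta> \<in> ext2_fibre E ?p"
      unfolding \<eta> by (intro subspace_sum subspace_add subspace_ext2_fibre wedge_in_ext2_fibre) auto
    moreover have "((\<lambda>r. pairing (pr (r *\<^sub>R d)) (\<xi> a r) (\<xi> b r) (\<omega> (pr (r *\<^sub>R d)))) has_real_derivative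
      pairing ?p (\<xi> a t) (\<xi> b t) \<eta>) (at t)" for a b
    proof (rule has_field_derivative_transform_within_open[OF _ open_line_preimage[OF V(1)]])
      show "((\<lambda>r. pairing (pr (r *\<^sub>R d)) (\<xi> a r) (\<xi> b r) (\<Sum>k<n. wedge (s k (pr (r *\<^sub>R d))) (s' k (pr (r *\<^sub>R d)))))
        has_real_derivative pairing ?p (\<xi> a t) (\<xi> b t) \<eta>) (at t)"
        unfolding \<eta> using \<xi> by (intro wedge_pairing_DERIV[OF V s]) (simp_all add: parallel_frame_def)
    qed (use V \<omega>_eq in auto)
    ultimately show ?thesis by blast
  qed
  have unique: "\<eta> = \<eta>'" if "R \<eta>" "R \<eta>'" for \<eta> \<eta>'
  proof (rule pairing_separates[of "\<lambda>i. \<xi> i t" ?p])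
    show "\<eta> \<in> ext2_fibre E ?p" "\<eta>' \<in> ext2_fibre E ?p" using R that by blast+
    show "pairing ?p (\<xi> a t) (\<xi> b t) \<eta> = pairing ?p (\<xi> a t) (\<xi> b t) \<eta>'" for a b
      by (rule DERIV_unique) (use R[OF that(1)] R[OF that(2)] in blast)+
  qed (simp_all add: parallel_frame_onb[OF \<xi>])
  obtain \<eta> where "R \<eta>" using ex ..
  then have "R (THE \<eta>. R \<eta>)" by (rule theI) (rule unique[OF _ \<open>R \<eta>\<close>])
  moreover have "ext2_connection E D d \<omega> ?p = (THE \<eta>. R \<eta>)"
    unfolding ext2_connection_def R_def ..
  ultimately have "R (ext2_connection E D d \<omega> ?p)" by (simp only:)
  from R[OF this] show ?thesis by blast
qed

lemma half_sections_ext2: "\<omega> \<in> half_sections E h \<epsilon> U \<Longrightarrow> \<omega> \<in> ext2_sections E U"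
  by (simp add: half_sections_def)

lemma parallel_half_section:
  assumes \<Omega>: "parallel_along (half_sections E h \<epsilon>) (ext2_connection E D) d \<Omega>"
    and \<xi>: "parallel_frame d \<xi>"
  shows "\<Omega> t \<in> ext2_fibre E (pr (t *\<^sub>R d))"
    and "((\<lambda>r. pairing (pr (r *\<^sub>R d)) (\<xi> a r) (\<xi> b r) (\<Omega> r)) has_real_derivative 0) (at t)"
proof -
  let ?p = "\<lambda>r. pr (r *\<^sub>R d)"
  have "has_covariant_derivative (half_sections E h \<epsilon>) (ext2_connection E D) d \<Omega> 0 t"
    using \<Omega> by (simp add: parallel_along_def)
  then obtain I U and n :: nat and f s where I: "open I" "t \<in> I" and U: "torus_open U" "\<forall>r\<in>I. ?p r \<in> U"
    and fs: "\<forall>k<n. smooth_fun_on I (f k) \<and> s k \<in> half_sections E h \<epsilon> U"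
    and \<Omega>_eq: "\<forall>r\<in>I. \<Omega> r = (\<Sum>k<n. f k r *\<^sub>R s k (?p r))"
    and zero: "0 = (\<Sum>k<n. deriv (f k) t *\<^sub>R s k (?p t) + f k t *\<^sub>R ext2_connection E D d (s k) (?p t))"
    unfolding has_covariant_derivative_def by blast
  have s: "s k \<in> ext2_sections E U" if "k < n" for k using fs that half_sections_ext2 by blast
  have "s k (?p t) \<in> ext2_fibre E (?p t)" if "k < n" for k
    using s[OF that] U I by (simp add: ext2_sections_def)
  then show "\<Omega> t \<in> ext2_fibre E (?p t)"
    using \<Omega>_eq I by (auto intro!: subspace_sum[OF subspace_ext2_fibre] subspace_scale[OF subspace_ext2_fibre])
  let ?b = "\<lambda>r. pairing (?p r) (\<xi> a r) (\<xi> b r)"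
  have f: "(f k has_real_derivative deriv (f k) t) (at t)" if "k < n" for k
    using fs that I smooth_fun_on_DERIV by blast
  have g: "((\<lambda>r. ?b r (s k (?p r))) has_real_derivative ?b t (ext2_connection E D d (s k) (?p t))) (at t)"
    if "k < n" for k
    using U I by (intro ext2_connection_DERIV[OF U(1) _ s[OF that] \<xi>]) blast
  have "((\<lambda>r. \<Sum>k<n. f k r * ?b r (s k (?p r))) has_real_derivative
      (\<Sum>k<n. deriv (f k) t * ?b t (s k (?p t)) + f k t * ?b t (ext2_connection E D d (s k) (?p t)))) (at t)"
    by (intro DERIV_sum) (auto intro!: derivative_eq_intros f g simp: algebra_simps)
  moreover have "(\<Sum>k<n. deriv (f k) t * ?b t (s k (?p t)) + f k t * ?b t (ext2_connection E D d (s k) (?p t)))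
      = ?b t (\<Sum>k<n. deriv (f k) t *\<^sub>R s k (?p t) + f k t *\<^sub>R ext2_connection E D d (s k) (?p t))"
    by (simp add: pairing_simps)
  ultimately have "((\<lambda>r. \<Sum>k<n. f k r * ?b r (s k (?p r))) has_real_derivative 0) (at t)"
    by (simp add: zero[symmetric] pairing_simps)
  then show "((\<lambda>r. ?b r (\<Omega> r)) has_real_derivative 0) (at t)"
    by (rule has_field_derivative_transform_within_open[OF _ I])
      (use \<Omega>_eq in \<open>simp add: pairing_simps\<close>)
qed

lemma pairing_Omega_frame:
  assumes "\<And>i j. metric_ext p (w i) (w j) = (if i = j then 1 else 0)"
    and "\<And>i j. metric_ext p' (w' i) (w' j) = (if i = j then 1 else 0)"
  shows "pairing p (w a) (w b) (Omega_frame \<epsilon> w k) = pairing p' (w' a) (w' b) (Omega_frame \<epsilon> w' k)"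
  unfolding Omega_frame_rot by (simp add: pairing_simps pairing_wedge assms)

lemma Omega_frame_in_ext2_fibre:
  "(\<And>i. w i \<in> fibre E p) \<Longrightarrow> Omega_frame \<epsilon> w k \<in> ext2_fibre E p"
  unfolding Omega_frame_rot
  by (intro subspace_scale subspace_add subspace_ext2_fibre wedge_in_ext2_fibre)

text \<open>Both sides have the same pairings with the parallel frame: those of the left-hand side are constant
because \<open>\<Omega>\<close> is parallel, and those of \<^const>\<open>Omega_frame\<close> are the same for all orthonormal bases.\<close>

lemma parallel_half_section_coordinates:
  assumes \<Omega>: "parallel_along (half_sections E h \<epsilon>) (ext2_connection E D) d \<Omega>"
    and \<xi>: "parallel_frame d \<xi>"
    and init: "\<Omega> 0 = (\<Sum>k\<in>UNIV. c k *\<^sub>R Omega_frame \<epsilon> (\<lambda>i. \<xi> i 0) k)"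
  shows "\<Omega> r = (\<Sum>k\<in>UNIV. c k *\<^sub>R Omega_frame \<epsilon> (\<lambda>i. \<xi> i r) k)"
proof (rule pairing_separates[of "\<lambda>i. \<xi> i r" "pr (r *\<^sub>R d)"])
  let ?b = "\<lambda>a b r. pairing (pr (r *\<^sub>R d)) (\<xi> a r) (\<xi> b r)"
  show "\<Omega> r \<in> ext2_fibre E (pr (r *\<^sub>R d))" by (rule parallel_half_section(1)[OF \<Omega> \<xi>])
  show "(\<Sum>k\<in>UNIV. c k *\<^sub>R Omega_frame \<epsilon> (\<lambda>i. \<xi> i r) k) \<in> ext2_fibre E (pr (r *\<^sub>R d))"
    by (intro subspace_sum subspace_scale subspace_ext2_fibre Omega_frame_in_ext2_fibre
        parallel_frame_onb(1)[OF \<xi>])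
  fix a b
  have "?b a b r (\<Omega> r) = ?b a b 0 (\<Omega> 0)"
    by (rule DERIV_isconst_all) (use parallel_half_section(2)[OF \<Omega> \<xi>] in blast)
  also have "\<dots> = (\<Sum>k\<in>UNIV. c k * ?b a b 0 (Omega_frame \<epsilon> (\<lambda>i. \<xi> i 0) k))"
    by (simp add: init pairing_simps)
  also have "\<dots> = (\<Sum>k\<in>UNIV. c k * ?b a b r (Omega_frame \<epsilon> (\<lambda>i. \<xi> i r) k))"
    by (intro sum.cong refl arg_cong2[where f = "(*)"]
        pairing_Omega_frame[OF parallel_frame_onb(2)[OF \<xi>] parallel_frame_onb(2)[OF \<xi>]])
  finally show "?b a b r (\<Omega> r) = ?b a b r (\<Sum>k\<in>UNIV. c k *\<^sub>R Omega_frame \<epsilon> (\<lambda>i. \<xi> i r) k)"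
    by (simp add: pairing_simps)
qed (simp_all add: parallel_frame_onb[OF \<xi>])

section \<open>Holonomy of the half bundles\<close>

lemma positive_onbD:
  assumes "positive_onb E h p v"
  shows "v i \<in> fibre E p" "metric_ext p (v i) (v j) = (if i = j then 1 else 0)"
proof -
  have *: "v i \<in> fibre E p" for i
  proof -
    obtain U e and M :: "real^4^4" where "(U, e) \<in> frames E" "p \<in> U"
      and "\<forall>j. v j = (\<Sum>i\<in>UNIV. M $ i $ j *\<^sub>R e i p)"
      using assms unfolding positive_onb_def positively_oriented_def by blast
    then show ?thesis
      by (auto intro!: subspace_sum[OF subspace_fibre] subspace_scale[OF subspace_fibre] frame_in_fibre)
  qed
  show "v i \<in> fibre E p" by (rule *)
  show "metric_ext p (v i) (v j) = (if i = j then 1 else 0)"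
    using assms by (simp add: metric_ext_eq[OF * *] positive_onb_def)
qed

text \<open>Both bases are expressed in local frames by matrices of positive determinant, and so is the
transition between the two frames. The matrix of the change of basis then has positive determinant, and
it is orthogonal.\<close>

lemma positive_onb_change:
  assumes v: "positive_onb E h p v" and w: "positive_onb E h p w"
  shows "\<exists>S\<in>SO. w = (\<lambda>j. \<Sum>i\<in>UNIV. S $ i $ j *\<^sub>R v i)"
proof -
  obtain U e and M :: "real^4^4" where e: "(U, e) \<in> frames E" "p \<in> U" and M: "det M > 0"
    and v_eq: "\<forall>j. v j = (\<Sum>i\<in>UNIV. M $ i $ j *\<^sub>R e i p)"
    using v unfolding positive_onb_def positively_oriented_def by blast
  obtain V f and N :: "real^4^4" where f: "(V, f) \<in> frames E" "p \<in> V" and N: "det N > 0"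
    and w_eq: "\<forall>j. w j = (\<Sum>i\<in>UNIV. N $ i $ j *\<^sub>R f i p)"
    using w unfolding positive_onb_def positively_oriented_def by blast
  obtain g :: "torus \<Rightarrow> real^4^4" where g: "\<forall>q \<in> U \<inter> V. det (g q) > 0 \<and>
      (\<forall>j. f j q = (\<Sum>i\<in>UNIV. g q $ i $ j *\<^sub>R e i q))"
    using frame_transition[OF e(1) f(1)] by blast
  have gp: "det (g p) > 0" "\<And>j. f j p = (\<Sum>i\<in>UNIV. g p $ i $ j *\<^sub>R e i p)"
    using g e f by auto
  have "invertible M" using M by (simp add: invertible_det_nz)
  then obtain M' where M': "M ** M' = mat 1" unfolding invertible_def by blast
  have e_eq: "e k p = (\<Sum>i\<in>UNIV. M' $ i $ k *\<^sub>R v i)" for k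
    unfolding v_eq[rule_format] matrix_comb_comb M'
    by (simp add: mat_def if_distrib[of "\<lambda>x. x *\<^sub>R _"] cong: if_cong)
  define S where "S = M' ** (g p ** N)"
  have w_S: "w j = (\<Sum>i\<in>UNIV. S $ i $ j *\<^sub>R v i)" for j
  proof -
    have "w j = (\<Sum>i\<in>UNIV. (g p ** N) $ i $ j *\<^sub>R e i p)"
      unfolding w_eq[rule_format] gp(2) matrix_comb_comb ..
    then show ?thesis unfolding e_eq matrix_comb_comb S_def .
  qed
  have "det M * det M' = 1" using M' by (metis det_I det_mul)
  then have "det M' > 0" using M by (metis zero_less_mult_pos zero_less_one)
  then have det_S: "det S > 0" using gp(1) N by (simp add: S_def det_mul)
  have "(transpose S ** S) $ a $ b = mat 1 $ a $ b" for a b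
  proof -
    have "(transpose S ** S) $ a $ b = metric_ext p (\<Sum>i\<in>UNIV. S $ i $ a *\<^sub>R v i) (\<Sum>i\<in>UNIV. S $ i $ b *\<^sub>R v i)"
      by (simp add: metric_ext_simps positive_onbD(2)[OF v] matrix_matrix_mult_def transpose_def
        if_distrib[of "(*) _"] mult.commute cong: if_cong)
    also have "\<dots> = mat 1 $ a $ b"
      unfolding w_S[symmetric] by (simp add: positive_onbD(2)[OF w] mat_def)
    finally show ?thesis .
  qed
  then have "orthogonal_matrix S" by (simp add: orthogonal_matrix vec_eq_iff)
  then have "S \<in> SO" using det_orthogonal_matrix[of S] det_S by (auto simp: SO_iff)
  then show ?thesis using w_S by blast
qed

text \<open>The basis \<open>\<omega>\<close> is given relative to some orthonormal basis \<open>e\<close> of the fibre; passing from \<open>e\<close> to \<open>v\<close>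
contributes an invertible factor \<^const>\<open>half_matrix\<close>.\<close>

lemma half_positive_onb_coordinates:
  assumes v: "positive_onb E h p v" and \<omega>: "half_positive_onb E h \<epsilon> p \<omega>"
  shows "\<exists>P. invertible P \<and> (\<forall>j. \<omega> j = (\<Sum>i\<in>UNIV. P $ i $ j *\<^sub>R Omega_frame \<epsilon> v i))"
proof -
  obtain e and M :: "real^3^3" where e: "positive_onb E h p e" and M: "det M > 0"
    and \<omega>_eq: "\<forall>j. \<omega> j = (\<Sum>i\<in>UNIV. M $ i $ j *\<^sub>R Omega_frame \<epsilon> e i)"
    using \<omega> unfolding half_positive_onb_def by blast
  obtain S where S: "S \<in> SO" and e_S: "e = (\<lambda>j. \<Sum>i\<in>UNIV. S $ i $ j *\<^sub>R v i)"
    using positive_onb_change[OF v e] by blast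
  have "det (half_matrix \<epsilon> (transpose S)) * det (half_matrix \<epsilon> S) = 1"
    by (metis half_matrix_transpose_mult[OF S] det_I det_mul)
  then have "invertible (half_matrix \<epsilon> S ** M)"
    using M by (auto simp: invertible_det_nz det_mul)
  moreover have "\<omega> j = (\<Sum>i\<in>UNIV. (half_matrix \<epsilon> S ** M) $ i $ j *\<^sub>R Omega_frame \<epsilon> v i)" for j
    unfolding \<omega>_eq[rule_format] e_S Omega_frame_change[OF S] matrix_comb_comb ..
  ultimately show ?thesis by blast
qed

text \<open>Parallel sections of the half bundle have constant coefficients \<open>P\<close> with respect to the frame built
from \<open>\<xi>\<close>. Comparing the two descriptions of their values after one turn gives the relation.\<close>

lemma half_holonomy_conjugate:
  assumes v: "positive_onb E h (pr (0, 0)) v"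
    and A: "holonomy_matrix (sections E) D d v A"
    and C: "holonomy_matrix (half_sections E h \<epsilon>) (ext2_connection E D) d \<omega> C"
    and \<omega>: "\<And>j. \<omega> j = (\<Sum>i\<in>UNIV. P $ i $ j *\<^sub>R Omega_frame \<epsilon> v i)"
  shows "half_matrix \<epsilon> A ** P = P ** C"
proof -
  let ?p = "pr (0, 0)"
  from A obtain \<xi> where A_SO: "A \<in> SO" and \<xi>: "\<And>i. parallel_along (sections E) D d (\<xi> i)"
    and \<xi>0: "\<And>i. \<xi> i 0 = v i" and \<xi>1: "\<And>a j. \<xi> j (a + 2 * pi) = (\<Sum>i\<in>UNIV. A $ i $ j *\<^sub>R \<xi> i a)"
    unfolding holonomy_matrix_def by blast
  from C obtain \<Omega> where \<Omega>: "\<And>i. parallel_along (half_sections E h \<epsilon>) (ext2_connection E D) d (\<Omega> i)"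
    and \<Omega>0: "\<And>i. \<Omega> i 0 = \<omega> i" and \<Omega>1: "\<And>a j. \<Omega> j (a + 2 * pi) = (\<Sum>i\<in>UNIV. C $ i $ j *\<^sub>R \<Omega> i a)"
    unfolding holonomy_matrix_def by blast
  have frame: "parallel_frame d \<xi>"
    using \<xi> by (simp add: parallel_frame_def \<xi>0 positive_onbD(2)[OF v])
  have \<Omega>_r: "\<Omega> j r = (\<Sum>i\<in>UNIV. P $ i $ j *\<^sub>R Omega_frame \<epsilon> (\<lambda>a. \<xi> a r) i)" for j r
    by (rule parallel_half_section_coordinates[OF \<Omega> frame]) (simp add: \<Omega>0 \<xi>0 \<omega>)
  have "(\<Sum>k\<in>UNIV. (half_matrix \<epsilon> A ** P) $ k $ j *\<^sub>R Omega_frame \<epsilon> v k) = \<Omega> j (0 + 2 * pi)" for j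
    unfolding \<Omega>_r \<xi>1 \<xi>0 Omega_frame_change[OF A_SO] matrix_comb_comb ..
  moreover have "\<Omega> j (0 + 2 * pi) = (\<Sum>k\<in>UNIV. (P ** C) $ k $ j *\<^sub>R Omega_frame \<epsilon> v k)" for j
    unfolding \<Omega>1 \<Omega>0 \<omega> matrix_comb_comb ..
  ultimately have eq: "(\<Sum>k\<in>UNIV. (half_matrix \<epsilon> A ** P) $ k $ j *\<^sub>R Omega_frame \<epsilon> v k) =
      (\<Sum>k\<in>UNIV. (P ** C) $ k $ j *\<^sub>R Omega_frame \<epsilon> v k)" for j
    by simp
  have dual: "metric_ext ?p (v b) (v a) = (if a = b then 1 else 0)" for a b
    using positive_onbD(2)[OF v] by auto
  have "(half_matrix \<epsilon> A ** P) $ k $ j = (P ** C) $ k $ j" for k j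
    by (rule Omega_frame_coeffs_eq[of "\<lambda>a x. metric_ext ?p x (v a)" v, OF linear_metric_ext_left dual eq])
  then show ?thesis by (simp add: vec_eq_iff)
qed

end

section \<open>Finiteness of the holonomy groups\<close>

lemma group_SO: "group (SO_group :: (real^'n^'n) monoid)"
proof (rule groupI)
  fix A :: "real^'n^'n" assume "A \<in> SO"
  then have "transpose A \<in> SO" "transpose A ** A = mat 1"
    by (simp_all add: SO_transpose) (simp add: SO_iff orthogonal_matrix_def)
  then show "\<exists>B\<in>SO. B \<otimes>\<^bsub>SO_group\<^esub> A = \<one>\<^bsub>SO_group\<^esub>"
    by (intro bexI[of _ "transpose A"]) (simp_all add: SO_group_def)
qed (auto simp: SO_group_def orthogonal_matrix_mul det_mul orthogonal_matrix_id matrix_mul_assoc)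

lemma SO_inv: "A \<in> SO \<Longrightarrow> inv\<^bsub>SO_group\<^esub> A = transpose A"
  by (rule group.inv_equality[OF group_SO])
    (simp_all add: SO_transpose, simp add: SO_group_def orthogonal_matrix_def)

text \<open>A relation \<open>R\<close> that is a subgroup of the product of two rotation groups and relates the generators
relates the generated groups. Used in both directions, it replaces a homomorphism theorem, because
conjugation by \<open>P\<close> is only a map to invertible matrices.\<close>

lemma generate_SO_related:
  assumes R: "\<And>A C. R A C \<Longrightarrow> A \<in> SO \<and> C \<in> SO" "R (mat 1) (mat 1)"
    "\<And>A C. R A C \<Longrightarrow> R (transpose A) (transpose C)"
    "\<And>A B C D. R A C \<Longrightarrow> R B D \<Longrightarrow> R (A ** B) (C ** D)"
    and XY: "\<And>A. A \<in> X \<Longrightarrow> \<exists>C\<in>Y. R A C"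
    and A: "A \<in> generate SO_group X"
  shows "\<exists>C\<in>generate SO_group Y. R A C"
  using A
proof (induction rule: generate.induct)
  case one
  have "mat 1 \<in> generate SO_group Y" using generate.one[of SO_group Y] by (simp add: SO_group_def)
  then show ?case using R(2) by (auto simp: SO_group_def)
next
  case (incl A)
  then show ?case using XY generate.incl by metis
next
  case (inv A)
  then obtain C where "C \<in> Y" "R A C" using XY by blast
  then show ?case using generate.inv[of C Y SO_group] R(1,3) SO_inv by metis
next
  case (eng A B)
  then obtain C D where "C \<in> generate SO_group Y" "R A C" "D \<in> generate SO_group Y" "R B D" by blast
  then have "C ** D \<in> generate SO_group Y" "R (A ** B) (C ** D)"
    using generate.eng[of C SO_group Y D] R(4) by (simp_all add: SO_group_def)
  then show ?case by (auto simp: SO_group_def)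
qed

text \<open>The two homomorphisms together have fibres of the form \<open>{B, - B}\<close>.\<close>

lemma finite_half_images_imp_finite:
  assumes G: "G \<subseteq> SO" and fin: "\<And>\<epsilon>. finite (half_matrix \<epsilon> ` G)"
  shows "finite G"
proof -
  let ?F = "\<lambda>A. (half_matrix Plus A, half_matrix Minus A)"
  have "?F ` G \<subseteq> half_matrix Plus ` G \<times> half_matrix Minus ` G" by auto
  then have "finite (?F ` G)" by (rule finite_subset) (simp add: fin)
  moreover have "finite {A \<in> G. ?F A = ?F B}" if "B \<in> G" for B
  proof (rule finite_subset)
    show "{A \<in> G. ?F A = ?F B} \<subseteq> {B, - B}"
    proof
      fix A assume A: "A \<in> {A \<in> G. ?F A = ?F B}"
      then have "half_matrix \<epsilon> A = half_matrix \<epsilon> B" for \<epsilon> by (cases \<epsilon>) auto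
      then show "A \<in> {B, - B}" using half_matrices_determine_up_to_sign[of A B] A that G by blast
    qed
  qed simp
  then have "finite (\<Union>y\<in>?F ` G. {A \<in> G. ?F A = y})"
    using calculation by (intro finite_UN_I) auto
  then show ?thesis by (rule rev_finite_subset) auto
qed

text \<open>The relation \<open>half_matrix \<epsilon> A ** P = P ** C\<close> is closed under products and transposes, so it passes from the
generators to the groups. As \<open>P\<close> is invertible, each side determines the other.\<close>

lemma finite_half_image_iff:
  fixes A1 A2 :: "real^4^4" and C1 C2 P :: "real^3^3"
  assumes SO: "A1 \<in> SO" "A2 \<in> SO" "C1 \<in> SO" "C2 \<in> SO" and P: "invertible P"
    and conj: "half_matrix \<epsilon> A1 ** P = P ** C1" "half_matrix \<epsilon> A2 ** P = P ** C2"
  shows "finite (half_matrix \<epsilon> ` generate SO_group {A1, A2}) \<longleftrightarrow> finite (generate SO_group {C1, C2})"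
    (is "finite (_ ` ?G) \<longleftrightarrow> finite ?H")
proof -
  obtain P' where P': "P ** P' = mat 1" "P' ** P = mat 1"
    using P unfolding invertible_def by blast
  define R where "R A C \<longleftrightarrow> A \<in> SO \<and> C \<in> SO \<and> half_matrix \<epsilon> A ** P = P ** C" for A C
  have R1: "R (mat 1) (mat 1)" by (simp add: R_def SO_one half_matrix_one)
  have RSO: "A \<in> SO \<and> C \<in> SO" if "R A C" for A C using that by (simp add: R_def)
  have Rt: "R (transpose A) (transpose C)" if "R A C" for A C
  proof -
    have C: "C ** transpose C = mat 1" and A: "A \<in> SO" "half_matrix \<epsilon> A ** P = P ** C"
      using that by (simp_all add: R_def SO_iff orthogonal_matrix_def)
    have "half_matrix \<epsilon> (transpose A) ** P = half_matrix \<epsilon> (transpose A) ** (P ** C) ** transpose C"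
      by (simp add: matrix_mul_assoc[symmetric] C)
    also have "\<dots> = (half_matrix \<epsilon> (transpose A) ** half_matrix \<epsilon> A) ** P ** transpose C"
      by (simp add: A(2)[symmetric] matrix_mul_assoc)
    finally have "half_matrix \<epsilon> (transpose A) ** P = P ** transpose C"
      by (simp add: half_matrix_transpose_mult[OF A(1)])
    then show ?thesis using that by (simp add: R_def SO_transpose)
  qed
  have Rm: "R (A ** B) (C ** D)" if "R A C" "R B D" for A B C D
  proof -
    have A: "half_matrix \<epsilon> A ** P = P ** C" and B: "half_matrix \<epsilon> B ** P = P ** D"
      and SO: "A \<in> SO" "B \<in> SO"
      using that by (simp_all add: R_def)
    have "half_matrix \<epsilon> (A ** B) ** P = half_matrix \<epsilon> A ** (half_matrix \<epsilon> B ** P)"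
      unfolding half_matrix_mult[OF SO] matrix_mul_assoc ..
    also have "\<dots> = half_matrix \<epsilon> A ** P ** D"
      unfolding B matrix_mul_assoc ..
    also have "\<dots> = P ** (C ** D)"
      unfolding A matrix_mul_assoc ..
    finally show ?thesis using that by (simp add: R_def SO_mult)
  qed
  have R_gen: "R A1 C1" "R A2 C2" using SO conj by (simp_all add: R_def)
  have GH: "\<exists>C\<in>?H. R A C" if "A \<in> ?G" for A
    by (rule generate_SO_related[of R, OF _ R1 _ _ _ that]) (use RSO Rt Rm R_gen in blast)+
  have HG: "\<exists>A\<in>?G. R A C" if "C \<in> ?H" for C
    by (rule generate_SO_related[of "\<lambda>C A. R A C", OF _ R1 _ _ _ that]) (use RSO Rt Rm R_gen in blast)+
  have R_eq: "half_matrix \<epsilon> A = P ** C ** P'" "C = P' ** half_matrix \<epsilon> A ** P" if "R A C" for A C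
  proof -
    have "half_matrix \<epsilon> A ** P = P ** C" using that by (simp add: R_def)
    then show "half_matrix \<epsilon> A = P ** C ** P'" "C = P' ** half_matrix \<epsilon> A ** P"
      by (metis P' matrix_mul_assoc matrix_mul_rid matrix_mul_lid)+
  qed
  show ?thesis
  proof
    assume "finite (half_matrix \<epsilon> ` ?G)"
    then have "finite ((\<lambda>X. P' ** X ** P) ` half_matrix \<epsilon> ` ?G)" by simp
    moreover have "?H \<subseteq> (\<lambda>X. P' ** X ** P) ` half_matrix \<epsilon> ` ?G" using HG R_eq(2) by blast
    ultimately show "finite ?H" by (rule rev_finite_subset)
  next
    assume "finite ?H"
    then have "finite ((\<lambda>C. P ** C ** P') ` ?H)" by simp
    moreover have "half_matrix \<epsilon> ` ?G \<subseteq> (\<lambda>C. P ** C ** P') ` ?H" using GH R_eq(1) by blast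
    ultimately show "finite (half_matrix \<epsilon> ` ?G)" by (rule rev_finite_subset)
  qed
qed

theorem proposition4p5:
  fixes E :: "'e::real_vector vbundle"
    and h :: "torus \<Rightarrow> 'e \<Rightarrow> 'e \<Rightarrow> real"
    and D :: "'e conn"
    and G :: "(real^4^4) set"
    and G_plus G_minus :: "(real^3^3) set"
  assumes "oriented_vbundle E"
    and "bundle_metric E h"
    and "metric_connection E h D"
    and "topological_holonomy_group E h D G"
    and "half_topological_holonomy_group E h D Plus G_plus"
    and "half_topological_holonomy_group E h D Minus G_minus"
  shows "finite G \<longleftrightarrow> finite G_plus \<and> finite G_minus"
proof -
  interpret metric_bundle_connection E h D
    using assms(1-3) by unfold_locales
  obtain v A1 A2 where v: "positive_onb E h (pr (0, 0)) v"
    and A: "holonomy_matrix (sections E) D (1, 0) v A1" "holonomy_matrix (sections E) D (0, 1) v A2"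
    and G: "G = generate SO_group {A1, A2}"
    using assms(4) unfolding topological_holonomy_group_def by blast
  have A_SO: "A1 \<in> SO" "A2 \<in> SO" using A by (simp_all add: holonomy_matrix_def)
  have half: "finite (half_matrix \<epsilon> ` G) \<longleftrightarrow> finite H"
    if "half_topological_holonomy_group E h D \<epsilon> H" for \<epsilon> H
  proof -
    obtain \<omega> C1 C2 where \<omega>: "half_positive_onb E h \<epsilon> (pr (0, 0)) \<omega>"
      and C: "holonomy_matrix (half_sections E h \<epsilon>) (ext2_connection E D) (1, 0) \<omega> C1"
        "holonomy_matrix (half_sections E h \<epsilon>) (ext2_connection E D) (0, 1) \<omega> C2"
      and H: "H = generate SO_group {C1, C2}"
      using \<open>half_topological_holonomy_group E h D \<epsilon> H\<close>
      unfolding half_topological_holonomy_group_def by blast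
    obtain P where P: "invertible P" "\<And>j. \<omega> j = (\<Sum>i\<in>UNIV. P $ i $ j *\<^sub>R Omega_frame \<epsilon> v i)"
      using half_positive_onb_coordinates[OF v \<omega>] by blast
    have "C1 \<in> SO" "C2 \<in> SO" using C by (simp_all add: holonomy_matrix_def)
    then show ?thesis
      unfolding G H using half_holonomy_conjugate[OF v A(1) C(1) P(2)]
        half_holonomy_conjugate[OF v A(2) C(2) P(2)]
      by (intro finite_half_image_iff[OF A_SO _ _ P(1)])
  qed
  have "G \<subseteq> SO"
    unfolding G using A_SO by (intro group.generate_incl[OF group_SO]) simp
  have "finite G \<longleftrightarrow> (\<forall>\<epsilon>. finite (half_matrix \<epsilon> ` G))"
    using finite_half_images_imp_finite[OF \<open>G \<subseteq> SO\<close>] by blast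
  also have "\<dots> \<longleftrightarrow> finite (half_matrix Plus ` G) \<and> finite (half_matrix Minus ` G)"
    by (metis polarity.exhaust)
  finally show ?thesis
    by (simp only: half[OF assms(5)] half[OF assms(6)])
qed

end
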